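(* Let $p\ge 1$ be a real number, let $f\in L^p(G_m)$, and let $\{q_k:k\in\mathbb{N}\}$ be a non-increasing sequence of nonnegative numbers with $q_0>0$ satisfying $\frac{1}{Q_n}=O\left(\frac1n\right)$ as $n\to\infty$. Then $$\|t_nf-f\|_p\to 0\quad\text{as } n\to\infty .$$
   Context: $\mathbb{N}=\{0,1,2,\dots\}$. Let $m=(m_0,m_1,\dots)$ be a bounded sequence of integers with $m_k\ge 2$ ($\sup_k m_k<\infty$). $Z_{m_k}=\{0,\dots,m_k-1\}$ is the additive group of integers modulo $m_k$ with discrete topology and uniform probability measure, and $G_m=\prod_{k\ge 0}Z_{m_k}$ is the complete direct product group (product topology, coordinatewise addition), with normalized Haar measure $\mu$ (the product measure). $L^p(G_m)$ is the usual complex Lebesgue space with respect to $\mu$. Put $M_0=1$, $M_{k+1}=m_kM_k$; every $n\in\mathbb{N}$ has a unique expansion $n=\sum_{j\ge0}n_jM_j$ with $n_j\in Z_{m_j}$. Generalized Rademacher functions: $r_k(x)=\exp(2\pi i x_k/m_k)$; Vilenkin functions: $\psi_n(x)=\prod_{k\ge 0}r_k(x)^{n_k}$. For $f\in L^1(G_m)$: $\widehat f(k)=\int_{G_m}f\,\overline{\psi_k}\,d\mu$ and $S_nf=\sum_{k=0}^{n-1}\widehat f(k)\psi_k$. For a nonnegative sequence $\{q_k\}$, $Q_n=\sum_{k=0}^{n-1}q_k$, and the Nörlund means are $t_nf=\frac1{Q_n}\sum_{k=1}^{n}q_{n-k}S_kf$ for $n\ge 1$. *)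

theory Defs
  imports "HOL-Probability.Probability" "HOL-Library.Landau_Symbols"
begin

text \<open>
  Elements of $G_m$ are the functions \<open>x :: nat \<Rightarrow> nat\<close> with \<open>x k < m k\<close> for all \<open>k\<close>. The normalized
  Haar measure is the product of the uniform probability measures on the factors.
\<close>

definition vilenkin_measure :: "(nat \<Rightarrow> nat) \<Rightarrow> (nat \<Rightarrow> nat) measure" where
  "vilenkin_measure m = PiM UNIV (\<lambda>k. uniform_count_measure {..<m k})"

definition gen_pow :: "(nat \<Rightarrow> nat) \<Rightarrow> nat \<Rightarrow> nat" where
  "gen_pow m k = (\<Prod>i<k. m i)"

definition digit :: "(nat \<Rightarrow> nat) \<Rightarrow> nat \<Rightarrow> nat \<Rightarrow> nat" where
  "digit m n j = (n div gen_pow m j) mod m j"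

definition rademacher :: "(nat \<Rightarrow> nat) \<Rightarrow> nat \<Rightarrow> (nat \<Rightarrow> nat) \<Rightarrow> complex" where
  "rademacher m k x = exp (2 * complex_of_real pi * \<i> * of_nat (x k) / of_nat (m k))"

text \<open>Only finitely many factors of the following infinite product differ from 1.\<close>

definition vilenkin :: "(nat \<Rightarrow> nat) \<Rightarrow> nat \<Rightarrow> (nat \<Rightarrow> nat) \<Rightarrow> complex" where
  "vilenkin m n x = (\<Prod>k. rademacher m k x ^ digit m n k)"

definition fourier_coeff :: "(nat \<Rightarrow> nat) \<Rightarrow> ((nat \<Rightarrow> nat) \<Rightarrow> complex) \<Rightarrow> nat \<Rightarrow> complex" where
  "fourier_coeff m f k = (\<integral>x. f x * cnj (vilenkin m k x) \<partial>vilenkin_measure m)"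

definition partial_sum ::
    "(nat \<Rightarrow> nat) \<Rightarrow> nat \<Rightarrow> ((nat \<Rightarrow> nat) \<Rightarrow> complex) \<Rightarrow> (nat \<Rightarrow> nat) \<Rightarrow> complex" where
  "partial_sum m n f x = (\<Sum>k<n. fourier_coeff m f k * vilenkin m k x)"

definition weight_sum :: "(nat \<Rightarrow> real) \<Rightarrow> nat \<Rightarrow> real" where
  "weight_sum q n = (\<Sum>k<n. q k)"

definition noerlund_mean ::
    "(nat \<Rightarrow> nat) \<Rightarrow> (nat \<Rightarrow> real) \<Rightarrow> nat \<Rightarrow> ((nat \<Rightarrow> nat) \<Rightarrow> complex) \<Rightarrow> (nat \<Rightarrow> nat) \<Rightarrow> complex" where
  "noerlund_mean m q n f x =
     of_real (1 / weight_sum q n) * (\<Sum>k=1..n. of_real (q (n - k)) * partial_sum m k f x)"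

text \<open>Members of $L^p$ are given by representatives, not by almost-everywhere classes.\<close>

definition Lp_space :: "'a measure \<Rightarrow> real \<Rightarrow> ('a \<Rightarrow> complex) set" where
  "Lp_space M p = {f \<in> borel_measurable M. integrable M (\<lambda>x. norm (f x) powr p)}"

text \<open>
  The integral below has the junk value 0 outside of \<open>Lp_space M p\<close>; the lemma
  \<open>noerlund_error_in_Lp\<close> shows that this case does not arise for $t_n f - f$.
\<close>

definition Lp_norm :: "'a measure \<Rightarrow> real \<Rightarrow> ('a \<Rightarrow> complex) \<Rightarrow> real" where
  "Lp_norm M p f = (\<integral>x. norm (f x) powr p \<partial>M) powr (1 / p)"


lemma gen_pow_rec: "gen_pow m 0 = 1" "gen_pow m (Suc k) = m k * gen_pow m k"
  by (simp_all add: gen_pow_def)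

lemma gen_pow_gt:
  assumes "\<And>k. 2 \<le> m k"
  shows "k < gen_pow m k"
proof (induction k)
  case (Suc k)
  have "2 * gen_pow m k \<le> m k * gen_pow m k"
    using assms by (intro mult_right_mono) auto
  with Suc show ?case unfolding gen_pow_rec by linarith
qed (simp add: gen_pow_rec)

lemma digit_eq_0:
  assumes "\<And>k. 2 \<le> m k" "n \<le> j"
  shows "digit m n j = 0"
  using gen_pow_gt[of m j] assms by (simp add: digit_def)

lemma expansion_mod: "(\<Sum>j<N. digit m n j * gen_pow m j) = n mod gen_pow m N"
proof (induction N)
  case (Suc N)
  have "n mod gen_pow m (Suc N) = gen_pow m N * digit m n N + n mod gen_pow m N"
    unfolding gen_pow_rec digit_def mult.commute[of "m N"] by (rule mod_mult2_eq)
  with Suc show ?case by (simp add: mult.commute)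
qed (simp add: gen_pow_rec)

lemma expansion_lt:
  assumes "\<And>j. d j < m j"
  shows "(\<Sum>j<N. d j * gen_pow m j) < gen_pow m N"
proof (induction N)
  case (Suc N)
  have "Suc (d N) * gen_pow m N \<le> m N * gen_pow m N"
    using assms[of N] by (intro mult_right_mono) auto
  with Suc show ?case by (simp add: gen_pow_rec)
qed (simp add: gen_pow_rec)

lemma digit_expansion:
  assumes "\<And>k. 2 \<le> m k"
  shows "digit m n j < m j" "finite {j. digit m n j \<noteq> 0}"
    "n = (\<Sum>j<n. digit m n j * gen_pow m j)"
proof -
  show "digit m n j < m j"
    using assms[of j] by (simp add: digit_def)
  have "{j. digit m n j \<noteq> 0} \<subseteq> {..<n}"
  proof
    fix j assume "j \<in> {j. digit m n j \<noteq> 0}"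
    then have "\<not> n \<le> j" using digit_eq_0[of m n j, OF assms] by auto
    then show "j \<in> {..<n}" by simp
  qed
  then show "finite {j. digit m n j \<noteq> 0}"
    by (rule finite_subset) simp
  show "n = (\<Sum>j<n. digit m n j * gen_pow m j)"
    unfolding expansion_mod by (rule mod_less[symmetric]) (rule gen_pow_gt, rule assms)
qed

lemma digit_unique:
  assumes "\<And>k. d k < m k" and "n = (\<Sum>j<N. d j * gen_pow m j)" and "j < N"
  shows "d j = digit m n j"
  using assms(2,3)
proof (induction N arbitrary: n)
  case (Suc N)
  define r where "r = (\<Sum>j<N. d j * gen_pow m j)"
  have r: "r < gen_pow m N" unfolding r_def by (rule expansion_lt) (rule assms(1))
  have n: "n = r + d N * gen_pow m N" using Suc.prems(1) by (simp add: r_def)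
  show ?case
  proof (cases "j = N")
    case True
    then show ?thesis using r n assms(1)[of N] by (simp add: digit_def)
  next
    case False
    then have j: "j < N" using Suc.prems by simp
    then have dr: "d j = digit m r j" using Suc.IH[OF r_def] by simp
    define c where "c = (\<Prod>i\<in>{Suc j..<N}. m i)"
    have "gen_pow m N = gen_pow m (Suc j) * (\<Prod>i\<in>{Suc j..<N}. m i)"
      unfolding gen_pow_def lessThan_atLeast0
      by (rule prod.atLeastLessThan_concat[symmetric]) (use j in auto)
    then have c: "gen_pow m N = gen_pow m j * (m j * c)"
      unfolding gen_pow_rec c_def by (simp only: ac_simps)
    have "gen_pow m j > 0" using r c by (cases "gen_pow m j") auto
    moreover have "n = r + gen_pow m j * (m j * (c * d N))"
      unfolding n c by (simp only: ac_simps)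
    ultimately have "n div gen_pow m j = r div gen_pow m j + m j * (c * d N)"
      by (simp only: div_mult_self2 less_irrefl)
    then have "digit m n j = digit m r j" unfolding digit_def by simp
    with dr show ?thesis by simp
  qed
qed simp

lemma vilenkin_finite:
  assumes "\<And>k. 2 \<le> m k"
  shows "vilenkin m n x = (\<Prod>k<n. rademacher m k x ^ digit m n k)"
  unfolding vilenkin_def
proof (rule prodinf_finite)
  fix k assume "k \<notin> {..<n}"
  then have "digit m n k = 0" by (intro digit_eq_0 assms) simp
  then show "rademacher m k x ^ digit m n k = 1" by simp
qed simp

lemma norm_rademacher: "norm (rademacher m k x) = 1"
proof -
  have "rademacher m k x = cis (2 * pi * real (x k) / real (m k))"
    by (simp add: rademacher_def cis_conv_exp mult_ac)
  then show ?thesis by simp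
qed

lemma norm_vilenkin:
  assumes "\<And>k. 2 \<le> m k"
  shows "norm (vilenkin m n x) = 1"
  by (simp add: vilenkin_finite[OF assms] prod_norm[symmetric] norm_power norm_rademacher)

lemma prob_space_vilenkin_measure:
  assumes "\<And>k. 2 \<le> m k"
  shows "prob_space (vilenkin_measure m)"
  unfolding vilenkin_measure_def
proof (rule prob_space_PiM)
  fix k show "prob_space (uniform_count_measure {..<m k})"
    using assms[of k] by (intro prob_space_uniform_count_measure) (auto simp: lessThan_empty_iff)
qed

lemma rademacher_measurable: "rademacher m k \<in> borel_measurable (vilenkin_measure m)"
proof -
  have 1: "(\<lambda>x. x k) \<in> measurable (vilenkin_measure m) (uniform_count_measure {..<m k})"
    unfolding vilenkin_measure_def by (rule measurable_component_singleton) simp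
  have 2: "(\<lambda>i. exp (2 * complex_of_real pi * \<i> * of_nat i / of_nat (m k)))
      \<in> borel_measurable (uniform_count_measure {..<m k})"
    by (simp add: measurable_def space_uniform_count_measure sets_uniform_count_measure)
  show ?thesis
    using measurable_compose[OF 1 2] by (simp add: rademacher_def[abs_def])
qed

lemma vilenkin_measurable:
  assumes "\<And>k. 2 \<le> m k"
  shows "vilenkin m n \<in> borel_measurable (vilenkin_measure m)"
proof -
  note [measurable] = rademacher_measurable
  show ?thesis
    unfolding vilenkin_finite[OF assms, abs_def] by measurable
qed

lemma noerlund_error_in_Lp:
  assumes "\<And>k. 2 \<le> m k" and "1 \<le> p" and "f \<in> Lp_space (vilenkin_measure m) p"
  shows "(\<lambda>x. noerlund_mean m q n f x - f x) \<in> Lp_space (vilenkin_measure m) p"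
proof -
  interpret prob_space "vilenkin_measure m"
    by (rule prob_space_vilenkin_measure) (rule assms(1))
  let ?M = "vilenkin_measure m"
  let ?t = "\<lambda>x. noerlund_mean m q n f x"
  note [measurable] = vilenkin_measurable[OF assms(1)]
  have [measurable]: "f \<in> borel_measurable ?M" and int: "integrable ?M (\<lambda>x. norm (f x) powr p)"
    using assms(3) by (auto simp: Lp_space_def)
  have [measurable]: "?t \<in> borel_measurable ?M"
    unfolding noerlund_mean_def partial_sum_def by measurable
  define C where "C = \<bar>1 / weight_sum q n\<bar> *
      (\<Sum>k=1..n. \<bar>q (n - k)\<bar> * (\<Sum>i<k. norm (fourier_coeff m f i)))"
  have t: "norm (?t x) \<le> C" for x
  proof -
    have "norm (partial_sum m k f x) \<le> (\<Sum>i<k. norm (fourier_coeff m f i))" for k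
      unfolding partial_sum_def
      by (rule order.trans[OF norm_sum]) (simp add: norm_mult norm_vilenkin[OF assms(1)])
    then have "norm (\<Sum>k=1..n. of_real (q (n - k)) * partial_sum m k f x)
        \<le> (\<Sum>k=1..n. \<bar>q (n - k)\<bar> * (\<Sum>i<k. norm (fourier_coeff m f i)))"
      by (intro order.trans[OF norm_sum] sum_mono) (auto simp: norm_mult intro!: mult_left_mono)
    then show ?thesis
      unfolding noerlund_mean_def C_def norm_mult norm_of_real by (intro mult_left_mono) auto
  qed
  have bound: "norm (?t x - f x) powr p \<le> (2 * C) powr p + 2 powr p * norm (f x) powr p" for x
  proof -
    have C0: "0 \<le> C" using t[of x] norm_ge_zero order.trans by blast
    have le: "norm (?t x - f x) \<le> C + norm (f x)"
      using norm_triangle_ineq4[of "?t x" "f x"] t[of x] by linarith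
    show ?thesis
    proof (cases "norm (f x) \<le> C")
      case True
      then have "norm (?t x - f x) powr p \<le> (2 * C) powr p"
        using le assms(2) by (intro powr_mono2) auto
      then show ?thesis by (simp add: add_increasing2)
    next
      case False
      then have "norm (?t x - f x) powr p \<le> (2 * norm (f x)) powr p"
        using le assms(2) by (intro powr_mono2) auto
      then show ?thesis by (simp add: powr_mult add_increasing)
    qed
  qed
  have "integrable ?M (\<lambda>x. norm (?t x - f x) powr p)"
  proof (rule Bochner_Integration.integrable_bound)
    show "integrable ?M (\<lambda>x. (2 * C) powr p + 2 powr p * norm (f x) powr p)"
      using int by auto
    show "AE x in ?M. norm (norm (?t x - f x) powr p)
        \<le> norm ((2 * C) powr p + 2 powr p * norm (f x) powr p)"
      using bound by (intro AE_I2) (simp add: add_nonneg_nonneg)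
  qed measurable
  then show ?thesis by (simp add: Lp_space_def)
qed

end

theory Submission imports Defs begin

text \<open>
  The means $t_n$ are integral operators whose kernels are averages of the Dirichlet kernels. Summation
  by parts reduces an $L^1$ bound for them, uniform in $n$, to the bound $\int |\sum_{k \le n} D_k| = O(n)$
  for the Fejer sums. The latter follows by writing $n = b M_N + j$: with $w = r_N(x) \overline{r_N(y)}$
  one has $D_{b M_N + j} = (\sum_{c<b} w^c) D_{M_N} + w^b D_j$, and $\sum_{c<m_N} w^c$ is nonnegative
  with mean 1 and independent of the coordinates below $N$. Schur's test then makes the $t_n$ uniformly
  bounded on $L^p$, so the functions with $t_n f \to f$ form a closed subspace. It contains the Vilenkin
  functions, hence the indicators of cylinders, by Dynkin's theorem all measurable indicators, and
  therefore all of $L^p$. Distances are measured by $\int |f - g|^p$, for which the quasi-triangle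
  inequality with constant $2^p$ suffices.
\<close>

text \<open>The integrals of |D_n| are not bounded in n, so the partial sums cannot be controlled
  one at a time and the averaging must be exploited. A Noerlund mean inherits the behaviour of the
  Fejer sums because its weights q_{n-k} grow with k: after summation by parts the differences have
  a constant sign and telescope, so their absolute values add up to at most q_0, and the boundary
  term contributes another q_0. Fejer sums of size O(n) then give kernels of L^1 norm O(n / Q_n),
  and 1/Q_n = O(1/n) is what makes this bounded. The same condition forces Q_n to tend to infinity,
  which yields convergence on each Vilenkin function. Boundedness of m enters through the incomplete
  geometric sums with b < m_N terms, which are estimated only by their number of terms.\<close>

lemma borel_measurable_cnj [measurable (raw)]:
  "f \<in> borel_measurable A \<Longrightarrow> (\<lambda>x. cnj (f x)) \<in> borel_measurable A"
  by (rule borel_measurable_continuous_on) (intro continuous_intros)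

section \<open>The group as a probability space with independent coordinates\<close>

locale vilenkin_group =
  fixes m :: "nat \<Rightarrow> nat"
  assumes m_ge_2: "2 \<le> m k"
begin

abbreviation "\<mu> \<equiv> vilenkin_measure m"

abbreviation "M \<equiv> gen_pow m"

abbreviation "\<psi> \<equiv> vilenkin m"

abbreviation "r \<equiv> rademacher m"

sublocale prob_space \<mu>
  by (rule prob_space_vilenkin_measure) (rule m_ge_2)

sublocale pair: pair_sigma_finite \<mu> \<mu> ..

lemma m_pos [simp]: "0 < m k"
  using m_ge_2[of k] by simp

lemma Suc_0_le_m [simp]: "Suc 0 \<le> m k"
  using m_ge_2[of k] by simp

lemma gen_pow_pos [simp]: "0 < M k"
  by (simp add: gen_pow_def)

lemma prob_space_factor: "prob_space (uniform_count_measure {..<m k})"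
  using m_ge_2[of k] by (intro prob_space_uniform_count_measure) (auto simp: lessThan_empty_iff)

lemma space_vilenkin_measure: "space \<mu> = {x. \<forall>k. x k < m k}"
  by (auto simp: vilenkin_measure_def space_PiM space_uniform_count_measure PiE_iff)

lemma component_measurable: "(\<lambda>x. x k) \<in> measurable \<mu> (uniform_count_measure {..<m k})"
  unfolding vilenkin_measure_def by (rule measurable_component_singleton) simp

lemma distr_component: "distr \<mu> (uniform_count_measure {..<m k}) (\<lambda>x. x k) = uniform_count_measure {..<m k}"
  unfolding vilenkin_measure_def by (rule distr_PiM_component) (auto intro: prob_space_factor)

lemma measurable_uniform_count [simp]: "h \<in> borel_measurable (uniform_count_measure A)"
  by (simp add: measurable_def space_uniform_count_measure sets_uniform_count_measure)

text \<open>The joint law of all coordinates is the law of the identity map, that is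
  \<open>\<mu>\<close> itself, and \<open>\<mu>\<close> is by construction the product of its
  marginals.\<close>

lemma indep_components:
  "indep_vars (\<lambda>k. uniform_count_measure {..<m k}) (\<lambda>k x. x k) UNIV"
proof (subst indep_vars_iff_distr_eq_PiM')
  show "distr \<mu> (PiM UNIV (\<lambda>k. uniform_count_measure {..<m k})) (\<lambda>x. \<lambda>i\<in>UNIV. x i)
     = PiM UNIV (\<lambda>k. distr \<mu> (uniform_count_measure {..<m k}) (\<lambda>x. x k))"
    unfolding distr_component by (simp add: vilenkin_measure_def restrict_UNIV distr_id2)
qed (auto intro: component_measurable)

lemma integral_component:
  fixes h :: "nat \<Rightarrow> 'b :: {banach, second_countable_topology}"
  shows "(\<integral>x. h (x k) \<partial>\<mu>) = (\<Sum>a<m k. h a) /\<^sub>R real (m k)"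
proof -
  have "(\<integral>x. h (x k) \<partial>\<mu>) = (\<integral>a. h a \<partial>distr \<mu> (uniform_count_measure {..<m k}) (\<lambda>x. x k))"
    by (subst integral_distr) (auto intro: component_measurable)
  also have "\<dots> = (\<Sum>a<m k. h a) /\<^sub>R real (m k)"
    unfolding distr_component unfolding uniform_count_measure_def
    by (subst lebesgue_integral_point_measure_finite) (auto simp: divideR_right scaleR_sum_right inverse_eq_divide)
  finally show ?thesis .
qed

lemma integrable_component:
  fixes h :: "nat \<Rightarrow> 'b :: {banach, second_countable_topology}"
  shows "integrable \<mu> (\<lambda>x. h (x k))"
proof (rule integrable_const_bound)
  show "(\<lambda>x. h (x k)) \<in> borel_measurable \<mu>"
    by (rule measurable_compose[OF component_measurable]) simp
  show "AE x in \<mu>. norm (h (x k)) \<le> (\<Sum>a<m k. norm (h a))"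
    by (rule AE_I2) (auto simp: space_vilenkin_measure intro!: member_le_sum)
qed

text \<open>This peels off coordinate \<open>N\<close> in the inductions over \<open>N\<close>
  below: a function of the earlier coordinates is independent of it, so the integral factors and the
  last factor is a finite average.\<close>

lemma integral_indep_component:
  fixes F :: "(nat \<Rightarrow> nat) \<Rightarrow> 'b :: {real_normed_field, banach, second_countable_topology}"
  assumes F: "integrable \<mu> F" and dep: "\<And>x y. (\<And>k. k < N \<Longrightarrow> x k = y k) \<Longrightarrow> F x = F y"
  shows "(\<integral>x. F x * h (x N) \<partial>\<mu>) = (\<integral>x. F x \<partial>\<mu>) * ((\<Sum>a<m N. h a) /\<^sub>R real (m N))"
    and "integrable \<mu> (\<lambda>x. F x * h (x N))"
proof -
  let ?U = "\<lambda>k. uniform_count_measure {..<m k}"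
  \<comment> \<open>\<open>e\<close> pads a point of the first \<open>N\<close> factors with zeros,
    which belong to every factor. It turns \<open>F\<close> into a function on the finite product,
    so that independence of disjoint blocks of coordinates applies.\<close>
  define e where "e = (\<lambda>x k. if k < N then x k else (0::nat))"
  have e: "e \<in> measurable (PiM {..<N} ?U) \<mu>"
    unfolding vilenkin_measure_def
  proof (rule measurable_PiM_single')
    fix k show "(\<lambda>x. e x k) \<in> measurable (PiM {..<N} ?U) (?U k)"
      by (cases "k < N")
        (auto simp: e_def space_uniform_count_measure intro!: measurable_component_singleton)
  qed (auto simp: space_PiM PiE_iff e_def space_uniform_count_measure)
  have "indep_var (PiM {..<N} ?U) (\<lambda>x. restrict (\<lambda>k. x k) {..<N}) (PiM {N} ?U) (\<lambda>x. restrict (\<lambda>k. x k) {N})"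
    by (rule indep_var_restrict[OF indep_components]) auto
  then have "indep_var borel ((\<lambda>x. F (e x)) \<circ> (\<lambda>x. restrict (\<lambda>k. x k) {..<N}))
      borel ((\<lambda>x. h (x N)) \<circ> (\<lambda>x. restrict (\<lambda>k. x k) {N}))"
  proof (rule indep_var_compose)
    show "(\<lambda>x. F (e x)) \<in> borel_measurable (PiM {..<N} ?U)"
      using F by (intro measurable_compose[OF e]) auto
    have "(\<lambda>x. x N) \<in> measurable (PiM {N} ?U) (?U N)"
      by (rule measurable_component_singleton) simp
    then show "(\<lambda>x. h (x N)) \<in> borel_measurable (PiM {N} ?U)"
      by (rule measurable_compose) simp
  qed
  moreover have "F (e (restrict x {..<N})) = F x" for x
    by (rule dep) (simp add: e_def)
  ultimately have *: "indep_var borel F borel (\<lambda>x. h (x N))"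
    by (simp add: comp_def)
  show "(\<integral>x. F x * h (x N) \<partial>\<mu>) = (\<integral>x. F x \<partial>\<mu>) * ((\<Sum>a<m N. h a) /\<^sub>R real (m N))"
    unfolding integral_component[symmetric]
    by (rule indep_var_lebesgue_integral[OF * F integrable_component])
  show "integrable \<mu> (\<lambda>x. F x * h (x N))"
    by (rule indep_var_integrable[OF * F integrable_component])
qed

section \<open>Characters, digits and orthogonality\<close>

lemma rademacher_power:
  "r k x ^ b = exp (2 * of_real pi * \<i> * of_nat (x k * b) / of_nat (m k))"
  by (simp add: rademacher_def exp_of_nat_mult[symmetric] field_simps)

text \<open>The sum is geometric with ratio an n-th root of unity, which is 1 exactly when the two
  frequencies agree.\<close>

lemma sum_roots_of_unity:
  assumes "b < n" "c < n"
  shows "(\<Sum>a<n. exp (2 * of_real pi * \<i> * of_nat (a * b) / of_nat n) *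
      cnj (exp (2 * of_real pi * \<i> * of_nat (a * c) / of_nat n))) = (if b = c then of_nat n else (0::complex))"
proof -
  define w :: "nat \<Rightarrow> complex" where "w b = exp (2 * of_real pi * \<i> * of_nat b / of_nat n)" for b
  define z where "z = w b * cnj (w c)"
  have w: "exp (2 * of_real pi * \<i> * of_nat (a * b) / of_nat n) = w b ^ a" for a b
    by (simp add: w_def exp_of_nat_mult[symmetric] field_simps)
  have wn: "w b ^ n = 1" for b
    using assms by (simp add: w_def complex_root_unity)
  have 1: "cnj (w b) * w b = 1" for b
    by (simp add: w_def exp_cnj flip: exp_add)
  have "z = 1 \<longleftrightarrow> w b = w c"
    using 1[of c] unfolding z_def by (metis mult.assoc mult.commute mult.left_neutral)
  also have "\<dots> \<longleftrightarrow> b = c"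
    using assms complex_root_unity_eq[of n b c] by (simp add: w_def)
  finally have z: "z = 1 \<longleftrightarrow> b = c" .
  have "z ^ n = 1" using wn[of b] wn[of c] by (simp add: z_def power_mult_distrib flip: complex_cnj_power)
  then have "(\<Sum>a<n. z ^ a) = (if b = c then of_nat n else 0)"
    using z by (auto simp: geometric_sum)
  then show ?thesis unfolding w z_def by (simp add: power_mult_distrib)
qed

text \<open>The exponent \<open>a * b\<close> is symmetric, so the orthogonality relation can be
  read with points and frequencies exchanged; here the sum runs over frequencies.\<close>

lemma sum_rademacher_pow:
  assumes "x k < m k" "y k < m k"
  shows "(\<Sum>b<m k. (r k x * cnj (r k y)) ^ b) = (if x k = y k then of_nat (m k) else 0)"
  using sum_roots_of_unity[OF assms]
  by (simp add: power_mult_distrib rademacher_power mult.commute flip: complex_cnj_power)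

lemma digit_less: "digit m n j < m j"
  by (simp add: digit_def)

lemma gen_pow_mono: "k \<le> l \<Longrightarrow> M k \<le> M l"
  by (rule lift_Suc_mono_le[of M]) (auto simp: gen_pow_rec)

text \<open>Putting the digit \<open>b\<close> at place \<open>N\<close> in front of a number below
  \<open>M N\<close> causes no carry. This is what makes the Vilenkin functions multiplicative under
  such a splitting.\<close>

lemma digit_add:
  assumes "j < M N" "b < m N"
  shows "digit m (b * M N + j) k = (if k < N then digit m j k else if k = N then b else 0)"
proof (cases "k \<le> N")
  case True
  define d where "d = (\<lambda>k. if k < N then digit m j k else if k = N then b else 0)"
  have "d i < m i" for i using assms by (auto simp: d_def digit_less)
  moreover have "b * M N + j = (\<Sum>i<Suc N. d i * M i)"
    using expansion_mod[of m j N] assms by (simp add: d_def)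
  ultimately have "d k = digit m (b * M N + j) k"
    using True by (intro digit_unique[where N = "Suc N" and d = d]) auto
  then show ?thesis by (simp add: d_def)
next
  case False
  have "b * M N + j < Suc b * M N" using assms by simp
  also have "\<dots> \<le> M (Suc N)" unfolding gen_pow_rec using assms by (intro mult_right_mono) auto
  also have "M (Suc N) \<le> M k"
    using False by (intro gen_pow_mono) simp
  finally show ?thesis using False by (simp add: digit_def)
qed

lemma vilenkin_eq_prod:
  assumes "n < M N"
  shows "\<psi> n x = (\<Prod>k<N. r k x ^ digit m n k)"
  unfolding vilenkin_def
proof (rule prodinf_finite)
  fix k assume "k \<notin> {..<N}"
  then have "n < M k" using assms gen_pow_mono[of N k] by simp
  then show "r k x ^ digit m n k = 1" by (simp add: digit_def)
qed simp

lemma vilenkin_add: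
  assumes "j < M N" "b < m N"
  shows "\<psi> (b * M N + j) x = r N x ^ b * \<psi> j x"
proof -
  have "b * M N + j < Suc b * M N" using assms by simp
  also have "\<dots> \<le> M (Suc N)" unfolding gen_pow_rec using assms by (intro mult_right_mono) auto
  finally have "\<psi> (b * M N + j) x = (\<Prod>k<Suc N. r k x ^ digit m (b * M N + j) k)"
    by (rule vilenkin_eq_prod)
  then show ?thesis using assms by (simp add: digit_add vilenkin_eq_prod[of j N] mult.commute)
qed

text \<open>Dependence on the first \<open>N\<close> coordinates only, in the form that
  \<open>integral_indep_component\<close> requires.\<close>

lemma vilenkin_cong:
  assumes "n < M N" "\<And>k. k < N \<Longrightarrow> x k = y k"
  shows "\<psi> n x = \<psi> n y"
  unfolding vilenkin_eq_prod[OF assms(1)] using assms(2) by (auto simp: rademacher_def intro!: prod.cong)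

lemmas [measurable] = vilenkin_measurable[of m, OF m_ge_2]
lemmas norm_vilenkin [simp] = norm_vilenkin[of m, OF m_ge_2]

lemma vilenkin_0: "\<psi> 0 x = 1"
  using vilenkin_eq_prod[of 0 0] by simp

text \<open>Splitting the top digit off both indices separates coordinate \<open>N\<close> from the
  earlier ones; the integral becomes the case \<open>N\<close> times the orthogonality relation of a
  cyclic group.\<close>

lemma vilenkin_orthonormal:
  assumes "i < M N" "j < M N"
  shows "(\<integral>x. \<psi> i x * cnj (\<psi> j x) \<partial>\<mu>) = (if i = j then 1 else 0)"
  using assms
proof (induction N arbitrary: i j)
  case 0
  then show ?case by (simp add: gen_pow_rec vilenkin_0 prob_space)
next
  case (Suc N)
  define i' j' b c where ij: "i' = i mod M N" "j' = j mod M N" "b = i div M N" "c = j div M N"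
  have b: "b < m N" "c < m N" using Suc.prems
    by (simp_all add: ij gen_pow_rec div_less_iff_less_mult)
  have i: "i = b * M N + i'" "j = c * M N + j'" "i' < M N" "j' < M N"
    unfolding ij by (simp_all only: div_mult_mod_eq mod_less_divisor gen_pow_pos)
  let ?F = "\<lambda>x. \<psi> i' x * cnj (\<psi> j' x)"
  let ?h = "\<lambda>a. exp (2 * of_real pi * \<i> * of_nat (a * b) / of_nat (m N)) *
      cnj (exp (2 * of_real pi * \<i> * of_nat (a * c) / of_nat (m N)))"
  have "(\<integral>x. \<psi> i x * cnj (\<psi> j x) \<partial>\<mu>) = (\<integral>x. ?F x * ?h (x N) \<partial>\<mu>)"
    using i b by (simp add: vilenkin_add rademacher_power mult_ac)
  also have "\<dots> = (\<integral>x. ?F x \<partial>\<mu>) * ((\<Sum>a<m N. ?h a) /\<^sub>R real (m N))"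
  proof (rule integral_indep_component)
    show "integrable \<mu> ?F" by (rule integrable_const_bound[where B=1]) (auto simp: norm_mult)
    fix x y :: "nat \<Rightarrow> nat" assume "\<And>k. k < N \<Longrightarrow> x k = y k"
    then have "\<psi> i' x = \<psi> i' y" "\<psi> j' x = \<psi> j' y"
      using i by (auto intro!: vilenkin_cong[of _ N])
    then show "?F x = ?F y" by simp
  qed
  also have "\<dots> = (if i = j then 1 else 0)"
    unfolding sum_roots_of_unity[OF b] Suc.IH[OF i(3,4)]
    using i by (auto simp: ij scaleR_conv_of_real)
  finally show ?case .
qed

section \<open>Dirichlet kernels and their sums: splitting off the top digit\<close>

text \<open>This is the character \<open>\<psi> i\<close> at the group difference of
  \<open>x\<close> and \<open>y\<close>. Keeping two separate points avoids subtraction in the group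
  and translation invariance of the measure.\<close>

definition kern :: "nat \<Rightarrow> (nat \<Rightarrow> nat) \<Rightarrow> (nat \<Rightarrow> nat) \<Rightarrow> complex" where
  "kern i x y = \<psi> i x * cnj (\<psi> i y)"

definition dirichlet :: "nat \<Rightarrow> (nat \<Rightarrow> nat) \<Rightarrow> (nat \<Rightarrow> nat) \<Rightarrow> complex" where
  "dirichlet n x y = (\<Sum>i<n. kern i x y)"

text \<open>The unnormalized Fejer kernel D_1 + ... + D_n; the shift by \<open>Suc\<close> matches
  the means, which start at S_1.\<close>

definition dirichlet_sum :: "nat \<Rightarrow> (nat \<Rightarrow> nat) \<Rightarrow> (nat \<Rightarrow> nat) \<Rightarrow> complex" where
  "dirichlet_sum n x y = (\<Sum>k<n. dirichlet (Suc k) x y)"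

definition root :: "nat \<Rightarrow> (nat \<Rightarrow> nat) \<Rightarrow> (nat \<Rightarrow> nat) \<Rightarrow> complex" where
  "root k x y = r k x * cnj (r k y)"

lemma norm_root [simp]: "norm (root k x y) = 1"
  by (simp add: root_def norm_mult norm_rademacher)

lemma norm_kern [simp]: "norm (kern i x y) = 1"
  by (simp add: kern_def norm_mult)

lemma kern_add: "j < M N \<Longrightarrow> b < m N \<Longrightarrow> kern (b * M N + j) x y = root N x y ^ b * kern j x y"
  by (simp add: kern_def root_def vilenkin_add power_mult_distrib)

lemma sum_lessThan_add: "(\<Sum>i<a + n. g i) = (\<Sum>i<a. g i) + (\<Sum>i<n. g (a + i))"
  for g :: "nat \<Rightarrow> 'b :: comm_monoid_add" and a n :: nat
  by (induction n) (auto simp: add.assoc)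

text \<open>The case \<open>j = M N\<close> is included although \<open>j\<close> is then no
  remainder: it completes block \<open>b\<close> and so drives the induction in
  \<open>dirichlet_mult\<close>.\<close>

lemma dirichlet_add_aux:
  assumes "j \<le> M N" "b < m N"
  shows "dirichlet (b * M N + j) x y = dirichlet (b * M N) x y + root N x y ^ b * dirichlet j x y"
  using assms by (simp add: dirichlet_def sum_lessThan_add kern_add sum_distrib_left)

lemma dirichlet_mult:
  "b \<le> m N \<Longrightarrow> dirichlet (b * M N) x y = (\<Sum>c<b. root N x y ^ c) * dirichlet (M N) x y"
proof (induction b)
  case (Suc b)
  then show ?case
    using dirichlet_add_aux[of "M N" N b x y] by (simp add: algebra_simps)
qed (simp add: dirichlet_def)

lemma dirichlet_add:
  assumes "j \<le> M N" "b < m N"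
  shows "dirichlet (b * M N + j) x y =
    (\<Sum>c<b. root N x y ^ c) * dirichlet (M N) x y + root N x y ^ b * dirichlet j x y"
  using dirichlet_add_aux[OF assms] dirichlet_mult[of b N] assms by simp

lemma dirichlet_gen_pow_Suc:
  "dirichlet (M (Suc N)) x y = dirichlet (M N) x y * (\<Sum>b<m N. root N x y ^ b)"
  using dirichlet_mult[of "m N" N x y] by (simp add: gen_pow_rec)

text \<open>Inside block \<open>b\<close> the contribution of the completed blocks to each Dirichlet
  kernel is constant, so a partial block of length \<open>j\<close> collects it \<open>j\<close>
  times.\<close>

lemma dirichlet_sum_add_aux:
  assumes "j \<le> M N" "b < m N"
  shows "dirichlet_sum (b * M N + j) x y = dirichlet_sum (b * M N) x y +
    of_nat j * (\<Sum>c<b. root N x y ^ c) * dirichlet (M N) x y + root N x y ^ b * dirichlet_sum j x y"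
proof -
  have "(\<Sum>k<j. dirichlet (Suc (b * M N + k)) x y) = (\<Sum>k<j.
      (\<Sum>c<b. root N x y ^ c) * dirichlet (M N) x y + root N x y ^ b * dirichlet (Suc k) x y)"
  proof (rule sum.cong)
    fix k assume "k \<in> {..<j}"
    then show "dirichlet (Suc (b * M N + k)) x y =
      (\<Sum>c<b. root N x y ^ c) * dirichlet (M N) x y + root N x y ^ b * dirichlet (Suc k) x y"
      using dirichlet_add[of "Suc k" N b x y] assms by simp
  qed simp
  then show ?thesis
    unfolding dirichlet_sum_def sum_lessThan_add by (simp add: sum.distrib sum_distrib_left mult_ac)
qed

text \<open>Block \<open>b'\<close> starts with the value of the Dirichlet kernel accumulated over
  the \<open>b'\<close> blocks before it and repeats it \<open>M N\<close> times; summing over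
  \<open>b'\<close> gives the double geometric sum.\<close>

lemma dirichlet_sum_mult:
  "b \<le> m N \<Longrightarrow> dirichlet_sum (b * M N) x y =
    of_nat (M N) * (\<Sum>b'<b. \<Sum>c<b'. root N x y ^ c) * dirichlet (M N) x y +
    (\<Sum>c<b. root N x y ^ c) * dirichlet_sum (M N) x y"
proof (induction b)
  case (Suc b)
  then show ?case
    using dirichlet_sum_add_aux[of "M N" N b x y] by (simp add: algebra_simps)
qed (simp add: dirichlet_sum_def)

lemma kern_cong: "n < M N \<Longrightarrow> (\<And>k. k < N \<Longrightarrow> y k = z k) \<Longrightarrow> kern n x y = kern n x z"
  unfolding kern_def using vilenkin_cong[of n N y z] by simp

lemma dirichlet_cong: "n \<le> M N \<Longrightarrow> (\<And>k. k < N \<Longrightarrow> y k = z k) \<Longrightarrow> dirichlet n x y = dirichlet n x z"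
  unfolding dirichlet_def by (auto intro!: sum.cong kern_cong[of _ N])

lemma dirichlet_sum_cong:
  "n \<le> M N \<Longrightarrow> (\<And>k. k < N \<Longrightarrow> y k = z k) \<Longrightarrow> dirichlet_sum n x y = dirichlet_sum n x z"
  unfolding dirichlet_sum_def by (auto intro!: sum.cong dirichlet_cong[of _ N])

lemma integrable_kern [simp]: "integrable \<mu> (\<lambda>y. kern i x y)"
  by (rule integrable_const_bound[where B=1]) (auto, simp add: kern_def)

lemma integrable_dirichlet [simp]: "integrable \<mu> (\<lambda>y. dirichlet n x y)"
  by (simp add: dirichlet_def)

lemma integrable_dirichlet_sum [simp]: "integrable \<mu> (\<lambda>y. dirichlet_sum n x y)"
  by (simp add: dirichlet_sum_def)

section \<open>L^1 bounds for the Fejer sums\<close>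

text \<open>\<open>r k\<close> reads only coordinate \<open>k\<close>, so a constant sequence
  exhibits \<open>root\<close> as a function of the single number \<open>y k\<close>.\<close>

lemma root_eq: "root k x y = r k x * cnj (r k (\<lambda>_. y k))"
  by (simp add: root_def rademacher_def)

text \<open>The geometric sum is \<open>m N\<close> times the indicator of \<open>x N = y N\<close>, so it has mean 1 in \<open>y\<close>.\<close>
lemma integral_norm_geometric:
  fixes F :: "(nat \<Rightarrow> nat) \<Rightarrow> complex"
  assumes x: "x \<in> space \<mu>" and F: "integrable \<mu> F"
    and dep: "\<And>y z. (\<And>k. k < N \<Longrightarrow> y k = z k) \<Longrightarrow> F y = F z"
  shows "(\<integral>y. norm (F y * (\<Sum>b<m N. root N x y ^ b)) \<partial>\<mu>) = (\<integral>y. norm (F y) \<partial>\<mu>)"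
    and "integrable \<mu> (\<lambda>y. F y * (\<Sum>b<m N. root N x y ^ b))"
proof -
  let ?h = "\<lambda>a. \<Sum>b<m N. (r N x * cnj (r N (\<lambda>_. a))) ^ b"
  have "(\<Sum>a<m N. norm (?h a)) = (\<Sum>a<m N. if a = x N then real (m N) else 0)"
    using x by (intro sum.cong) (auto simp: sum_rademacher_pow space_vilenkin_measure)
  also have "\<dots> = m N" using x by (simp add: space_vilenkin_measure)
  finally have "(\<Sum>a<m N. norm (?h a)) /\<^sub>R real (m N) = 1" by simp
  moreover have "(\<integral>y. norm (F y) * norm (?h (y N)) \<partial>\<mu>) = (\<integral>y. norm (F y) \<partial>\<mu>) * ((\<Sum>a<m N. norm (?h a)) /\<^sub>R real (m N))"
    by (rule integral_indep_component[OF integrable_norm[OF F] arg_cong[of _ _ norm, OF dep]])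
  ultimately show "(\<integral>y. norm (F y * (\<Sum>b<m N. root N x y ^ b)) \<partial>\<mu>) = (\<integral>y. norm (F y) \<partial>\<mu>)"
    by (simp add: root_eq norm_mult)
  show "integrable \<mu> (\<lambda>y. F y * (\<Sum>b<m N. root N x y ^ b))"
    unfolding root_eq by (rule integral_indep_component(2)[OF F dep])
qed

lemma integral_norm_dirichlet_gen_pow:
  assumes x: "x \<in> space \<mu>"
  shows "(\<integral>y. norm (dirichlet (M N) x y) \<partial>\<mu>) = 1"
proof (induction N)
  case 0
  then show ?case by (simp add: gen_pow_rec dirichlet_def prob_space)
next
  case (Suc N)
  then show ?case unfolding dirichlet_gen_pow_Suc
    by (subst integral_norm_geometric[OF x]) (auto intro: dirichlet_cong)
qed

lemma integral_norm_bound: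
  fixes F :: "(nat \<Rightarrow> nat) \<Rightarrow> complex" and g :: "(nat \<Rightarrow> nat) \<Rightarrow> real"
  assumes "integrable \<mu> g" "\<And>y. norm (F y) \<le> g y" "(\<integral>y. g y \<partial>\<mu>) \<le> B"
  shows "(\<integral>y. norm (F y) \<partial>\<mu>) \<le> B"
proof -
  have "(\<integral>y. norm (F y) \<partial>\<mu>) \<le> (\<integral>y. g y \<partial>\<mu>)"
    using assms(1,2) by (intro integral_mono' order.trans[OF norm_ge_zero assms(2)]) auto
  with assms(3) show ?thesis by simp
qed

lemma norm_geometric_le: "norm (\<Sum>c<b. root N x y ^ c) \<le> real b"
  using sum_norm_le[of "{..<b}" "\<lambda>c. root N x y ^ c" "\<lambda>_. 1"] by (simp add: norm_power)

lemma norm_double_geometric_le: "norm (\<Sum>b'<b. \<Sum>c<b'. root N x y ^ c) \<le> (real b)\<^sup>2"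
proof -
  have "norm (\<Sum>b'<b. \<Sum>c<b'. root N x y ^ c) \<le> (\<Sum>b'<b. real b)"
    by (rule sum_norm_le) (auto intro: order.trans[OF norm_geometric_le])
  then show ?thesis by (simp add: power2_eq_square)
qed

text \<open>Estimating the full geometric sum by \<open>m N\<close> pointwise would only give order
  \<open>N * M N\<close>, a logarithm too much. Since it has mean 1 and is independent of the lower
  coordinates, the old integral is instead carried over unchanged, and each level adds at most d^2
  \<open>M N\<close>. The resulting 2 d^2 \<open>M N\<close> fits under the next bound because
  \<open>m N\<close> is at least 2.\<close>

lemma integral_norm_dirichlet_sum_gen_pow:
  assumes x: "x \<in> space \<mu>" and d: "\<And>k. m k \<le> d"
  shows "(\<integral>y. norm (dirichlet_sum (M N) x y) \<partial>\<mu>) \<le> (real d)\<^sup>2 * real (M N)"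
proof (induction N)
  case 0
  have "1 \<le> d" using d[of 0] m_ge_2[of 0] by simp
  then show ?case by (simp add: gen_pow_rec dirichlet_sum_def dirichlet_def prob_space)
next
  case (Suc N)
  let ?g = "\<lambda>y. dirichlet_sum (M N) x y * (\<Sum>b<m N. root N x y ^ b)"
  let ?D = "\<lambda>y. dirichlet (M N) x y"
  have g: "(\<integral>y. norm (?g y) \<partial>\<mu>) = (\<integral>y. norm (dirichlet_sum (M N) x y) \<partial>\<mu>)" "integrable \<mu> ?g"
    by (rule integral_norm_geometric[OF x integrable_dirichlet_sum dirichlet_sum_cong[OF order.refl]], simp)+
  show ?case
  proof (rule integral_norm_bound)
    show "integrable \<mu> (\<lambda>y. (real d)\<^sup>2 * M N * norm (?D y) + norm (?g y))"
      using g by (intro Bochner_Integration.integrable_add integrable_norm integrable_mult_right) auto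
    have "(\<integral>y. (real d)\<^sup>2 * M N * norm (?D y) + norm (?g y) \<partial>\<mu>)
       = (real d)\<^sup>2 * M N + (\<integral>y. norm (?g y) \<partial>\<mu>)"
      using g(2) by (subst Bochner_Integration.integral_add)
        (auto simp: integral_norm_dirichlet_gen_pow[OF x] intro!: integrable_mult_right integrable_norm)
    also have "\<dots> \<le> (real d)\<^sup>2 * (2 * real (M N))" using Suc unfolding g by (simp add: mult_ac)
    also have "\<dots> \<le> (real d)\<^sup>2 * real (M (Suc N))"
      unfolding gen_pow_rec of_nat_mult using m_ge_2[of N] by (intro mult_left_mono mult_right_mono) auto
    finally show "(\<integral>y. (real d)\<^sup>2 * M N * norm (?D y) + norm (?g y) \<partial>\<mu>) \<le> (real d)\<^sup>2 * real (M (Suc N))" .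
    show "norm (dirichlet_sum (M (Suc N)) x y) \<le> (real d)\<^sup>2 * M N * norm (?D y) + norm (?g y)" for y
    proof -
      have "norm (\<Sum>b'<m N. \<Sum>c<b'. root N x y ^ c) \<le> (real d)\<^sup>2"
        using d[of N] by (intro order.trans[OF norm_double_geometric_le]) (simp add: power_mono)
      then have "norm (\<Sum>b'<m N. \<Sum>c<b'. root N x y ^ c) * (M N * norm (?D y)) \<le> (real d)\<^sup>2 * (M N * norm (?D y))"
        by (rule mult_right_mono) simp
      then have "norm (of_nat (M N) * (\<Sum>b'<m N. \<Sum>c<b'. root N x y ^ c) * ?D y) \<le> (real d)\<^sup>2 * M N * norm (?D y)"
        by (simp add: norm_mult mult_ac)
      then show ?thesis
        unfolding gen_pow_rec dirichlet_sum_mult[of "m N" N, OF order.refl]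
        by (intro norm_triangle_le) (simp add: mult_ac)
    qed
  qed
qed

text \<open>Removing the top digit leaves the remainder \<open>j\<close> multiplied by a power of
  \<open>root\<close>, which has modulus 1, so the recursion costs no factor. The other terms cost a
  multiple of \<open>M N\<close>, and this is paid for by the drop from \<open>n\<close> to
  \<open>j\<close>.\<close>

lemma integral_norm_dirichlet_sum:
  assumes x: "x \<in> space \<mu>" and d: "\<And>k. m k \<le> d"
  shows "(\<integral>y. norm (dirichlet_sum n x y) \<partial>\<mu>) \<le> (real d + (real d)\<^sup>2 + (real d)^3) * real n"
proof -
  \<comment> \<open>The summands are the costs of a nonzero top digit in units of
    \<open>M N\<close>: d^2 for the double geometric sum times \<open>dirichlet (M N)\<close>, d^3
    for at most d copies of \<open>dirichlet_sum (M N)\<close> of size d^2 \<open>M N\<close> each,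
    and d for the geometric sum repeated \<open>j\<close> times, with \<open>j\<close> below
    \<open>M N\<close>.\<close>
  define K where "K = real d + (real d)\<^sup>2 + (real d)^3"
  have "n < M N \<Longrightarrow> (\<integral>y. norm (dirichlet_sum n x y) \<partial>\<mu>) \<le> K * real n" for N
  proof (induction N arbitrary: n)
    case 0
    then show ?case by (simp add: gen_pow_rec dirichlet_sum_def)
  next
    case (Suc N)
    define b j where bj: "b = n div M N" "j = n mod M N"
    have b: "b < m N" using Suc.prems by (simp add: bj gen_pow_rec div_less_iff_less_mult)
    have j: "j < M N" and n: "n = b * M N + j"
      unfolding bj by (simp_all only: div_mult_mod_eq mod_less_divisor gen_pow_pos)
    let ?D = "\<lambda>y. norm (dirichlet (M N) x y)"
    let ?L = "\<lambda>n y. norm (dirichlet_sum n x y)"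
    let ?g = "\<lambda>y. (real d)\<^sup>2 * M N * ?D y + real d * ?L (M N) y + M N * real d * ?D y + ?L j y"
    show ?case
    \<comment> \<open>A zero digit must be skipped without charge: the cost \<open>M N\<close> is at
      most \<open>b * M N\<close> only for nonzero \<open>b\<close>.\<close>
    proof (cases "b = 0")
      case True
      with j n Suc.IH show ?thesis by simp
    next
      case False
      have [simp]: "integrable \<mu> (\<lambda>y. norm (dirichlet n x y))" "integrable \<mu> (\<lambda>y. ?L n y)" for n
        by (intro integrable_norm integrable_dirichlet integrable_dirichlet_sum)+
      show ?thesis
      proof (rule integral_norm_bound)
        show "integrable \<mu> ?g" by simp
        have "(\<integral>y. ?g y \<partial>\<mu>) = (real d)\<^sup>2 * M N + real d * (\<integral>y. ?L (M N) y \<partial>\<mu>) + M N * real d + (\<integral>y. ?L j y \<partial>\<mu>)"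
          by (simp add: integral_norm_dirichlet_gen_pow[OF x])
        also have "\<dots> \<le> (real d)\<^sup>2 * M N + real d * ((real d)\<^sup>2 * real (M N)) + M N * real d + K * j"
          by (intro add_mono mult_left_mono integral_norm_dirichlet_sum_gen_pow x d Suc.IH j) auto
        also have "\<dots> = K * (M N + j)" by (simp add: K_def algebra_simps power2_eq_square power3_eq_cube)
        also have "\<dots> \<le> K * n"
        proof (rule mult_left_mono)
          have "1 * M N \<le> b * M N" using False by (intro mult_right_mono) auto
          then show "real (M N + j) \<le> real n" by (simp add: n)
        qed (simp add: K_def)
        finally show "(\<integral>y. ?g y \<partial>\<mu>) \<le> K * n" .
        show "?L n y \<le> ?g y" for y
        proof -
          have db: "real b \<le> real d" using b d[of N] by simp
          have "?L n y \<le> norm (of_nat (M N) * (\<Sum>b'<b. \<Sum>c<b'. root N x y ^ c) * dirichlet (M N) x y)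
              + norm ((\<Sum>c<b. root N x y ^ c) * dirichlet_sum (M N) x y)
              + norm (of_nat j * (\<Sum>c<b. root N x y ^ c) * dirichlet (M N) x y)
              + norm (root N x y ^ b * dirichlet_sum j x y)"
            unfolding n dirichlet_sum_add_aux[OF less_imp_le[OF j] b] dirichlet_sum_mult[OF less_imp_le[OF b]]
            by (intro norm_triangle_mono order.refl)
          also have "\<dots> \<le> M N * (real d)\<^sup>2 * ?D y + real d * ?L (M N) y + M N * real d * ?D y + 1 * ?L j y"
          proof -
            have "norm (\<Sum>b'<b. \<Sum>c<b'. root N x y ^ c) \<le> (real d)\<^sup>2"
              using norm_double_geometric_le power_mono[OF db, of 2] by (rule order.trans) simp
            moreover have "norm (\<Sum>c<b. root N x y ^ c) \<le> real d"
              using norm_geometric_le db by (rule order.trans)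
            ultimately show ?thesis
              unfolding norm_mult norm_of_nat norm_power norm_root power_one using j
              by (intro add_mono mult_mono order.refl mult_nonneg_nonneg norm_ge_zero) simp_all
          qed
          finally show ?thesis by (simp add: mult_ac)
        qed
      qed
    qed
  qed
  from this[OF gen_pow_gt[of m n, OF m_ge_2]] show ?thesis by (simp add: K_def)
qed

section \<open>Noerlund kernels and summation by parts\<close>

definition noerlund_kern :: "(nat \<Rightarrow> real) \<Rightarrow> nat \<Rightarrow> (nat \<Rightarrow> nat) \<Rightarrow> (nat \<Rightarrow> nat) \<Rightarrow> complex" where
  "noerlund_kern q n x y = of_real (1 / weight_sum q n) * (\<Sum>k=1..n. of_real (q (n - k)) * dirichlet k x y)"

text \<open>Passing from \<open>n\<close> to \<open>Suc n\<close> shifts all earlier weights by one,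
  hence the induction generalizes \<open>q\<close> and uses the shifted sequence. Writing the later
  index as \<open>Suc (n - Suc k)\<close> makes each coefficient a difference of consecutive
  weights.\<close>

lemma weighted_dirichlet_sum_by_parts:
  "(\<Sum>k=1..n. of_real (q (n - k)) * dirichlet k x y) =
    of_real (q 0) * dirichlet_sum n x y -
    (\<Sum>k<n. of_real (q (n - Suc k) - q (Suc (n - Suc k))) * dirichlet_sum k x y)"
proof (induction n arbitrary: q)
  case (Suc n)
  have "(\<Sum>k=1..n. of_real (q (Suc n - k)) * dirichlet k x y) =
      (\<Sum>k=1..n. of_real (q (Suc (n - k))) * dirichlet k x y)"
    by (intro sum.cong) (auto simp: Suc_diff_le)
  moreover have "(\<Sum>k<n. of_real (q (Suc (n - Suc k)) - q (Suc (Suc (n - Suc k)))) * dirichlet_sum k x y) =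
      (\<Sum>k<n. of_real (q (n - k) - q (Suc (n - k))) * dirichlet_sum k x y)"
    by (intro sum.cong) (auto simp: Suc_diff_Suc)
  ultimately show ?case
    using Suc.IH[of "\<lambda>k. q (Suc k)"] by (simp add: dirichlet_sum_def algebra_simps)
qed (simp add: dirichlet_sum_def)

text \<open>The coefficients after summation by parts are nonnegative and telescope to
  \<open>q 0 - q n\<close>; with \<open>q 0\<close> from the boundary term this makes at most
  \<open>2 * q 0\<close>. Every Fejer sum involved has index at most \<open>n\<close>, so its
  integral is bounded by the value for \<open>n\<close>.\<close>

lemma integral_norm_noerlund_kern:
  assumes x: "x \<in> space \<mu>" and d: "\<And>k. m k \<le> d" and q: "decseq q" "\<And>k. 0 \<le> q k"
  shows "(\<integral>y. norm (noerlund_kern q n x y) \<partial>\<mu>) \<le>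
    1 / weight_sum q n * (2 * q 0 * ((real d + (real d)\<^sup>2 + (real d)^3) * real n))"
proof (rule integral_norm_bound)
  define K where "K = real d + (real d)\<^sup>2 + (real d)^3"
  have K: "0 \<le> K" by (simp add: K_def)
  define W where "W = 1 / weight_sum q n"
  have W: "0 \<le> W" using q(2) by (simp add: weight_sum_def W_def sum_nonneg)
  let ?L = "\<lambda>n y. norm (dirichlet_sum n x y)"
  let ?q = "\<lambda>k. q (n - Suc k) - q (Suc (n - Suc k))"
  let ?g = "\<lambda>y. W * (q 0 * ?L n y + (\<Sum>k<n. ?q k * ?L k y))"
  have [simp]: "integrable \<mu> (\<lambda>y. ?L n y)" for n
    by (intro integrable_norm integrable_dirichlet_sum)
  have q_pos: "0 \<le> ?q k" for k using q(1) by (simp add: decseq_SucD)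
  show "integrable \<mu> (\<lambda>y. 1 / weight_sum q n * (q 0 * ?L n y + (\<Sum>k<n. ?q k * ?L k y)))" by simp
  show "norm (noerlund_kern q n x y) \<le> 1 / weight_sum q n * (q 0 * ?L n y + (\<Sum>k<n. ?q k * ?L k y))" for y
    unfolding noerlund_kern_def weighted_dirichlet_sum_by_parts norm_mult W_def[symmetric]
  proof (intro mult_mono norm_triangle_le_diff add_mono)
    show "norm (\<Sum>k<n. complex_of_real (?q k) * dirichlet_sum k x y) \<le> (\<Sum>k<n. ?q k * ?L k y)"
      by (intro order.trans[OF norm_sum] sum_mono) (use q_pos in \<open>simp add: norm_mult del: of_real_diff\<close>)
    show "norm (of_real (q 0) * dirichlet_sum n x y) \<le> q 0 * ?L n y"
      using q(2)[of 0] by (simp add: norm_mult)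
  qed (use W in simp_all)
  have tel: "(\<Sum>k<n. ?q k) = q 0 - q n"
    using sum.nat_diff_reindex[of "\<lambda>k. q k - q (Suc k)" n] sum_lessThan_telescope'[of q n] by simp
  have "(\<integral>y. ?g y \<partial>\<mu>) = W * (q 0 * (\<integral>y. ?L n y \<partial>\<mu>) + (\<Sum>k<n. ?q k * (\<integral>y. ?L k y \<partial>\<mu>)))"
    by simp
  also have "\<dots> \<le> W * (q 0 * (K * n) + (\<Sum>k<n. ?q k * (K * n)))"
  proof (intro mult_left_mono add_mono sum_mono q_pos)
    fix k assume "k \<in> {..<n}"
    then have "K * k \<le> K * n" using K by (intro mult_left_mono) auto
    then show "(\<integral>y. ?L k y \<partial>\<mu>) \<le> K * n"
      using integral_norm_dirichlet_sum[OF x d, of k] by (simp add: K_def)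
  qed (use integral_norm_dirichlet_sum[OF x d, of n] W q in \<open>auto simp: K_def\<close>)
  also have "\<dots> = W * ((2 * q 0 - q n) * (K * n))"
    unfolding sum_distrib_right[symmetric] tel by (simp add: algebra_simps)
  also have "\<dots> \<le> W * (2 * q 0 * (K * n))"
    using q(2) K W by (intro mult_left_mono mult_right_mono) auto
  finally show "(\<integral>y. 1 / weight_sum q n * (q 0 * ?L n y + (\<Sum>k<n. ?q k * ?L k y)) \<partial>\<mu>)
      \<le> 1 / weight_sum q n * (2 * q 0 * ((real d + (real d)\<^sup>2 + (real d)^3) * real n))"
    by (simp add: W_def K_def)
qed

end

section \<open>Integral operators on L^p: the Schur test\<close>

text \<open>The convex function \<open>u powr p\<close> lies above its tangent at \<open>s\<close>.
  Solved for the linear term, this can be integrated against a weight and replaces Young's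
  inequality.\<close>

lemma powr_above_tangent:
  fixes p s u :: real
  assumes "1 \<le> p" "0 < s" "0 \<le> u"
  shows "p * s powr (p - 1) * u \<le> u powr p + (p - 1) * s powr p"
proof (cases "u = 0")
  case False
  have "u powr p - s powr p \<ge> (p * s powr (p - 1)) * (u - s)"
    using assms False
    by (intro convex_on_imp_above_tangent[OF powr_convex, of p s u])
       (auto intro!: derivative_eq_intros simp: interior_open powr_diff)
  moreover have "s powr (p - 1) * s = s powr p"
    using assms by (simp add: powr_diff)
  ultimately show ?thesis by (simp add: algebra_simps)
qed (use assms in simp)

text \<open>Hoelder's inequality for the weight |k|. The tangent argument involves no conjugate
  exponent, so \<open>p = 1\<close> is not a special case, and the right-hand side may be
  infinite.\<close>

lemma norm_integral_powr_le:
  fixes k f :: "'a \<Rightarrow> complex" and p B :: real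
  assumes [measurable]: "k \<in> borel_measurable A" "f \<in> borel_measurable A"
    and p: "1 \<le> p" and B: "0 < B" "(\<integral>\<^sup>+y. ennreal (norm (k y)) \<partial>A) \<le> ennreal B"
  shows "ennreal (norm (\<integral>y. k y * f y \<partial>A) powr p) \<le>
    ennreal (B powr (p - 1)) * (\<integral>\<^sup>+y. ennreal (norm (k y) * norm (f y) powr p) \<partial>A)"
proof (cases "(\<integral>y. k y * f y \<partial>A) = 0")
  case False
  \<comment> \<open>The tangent point is the size that a constant \<open>f\<close> would need to
    produce this integral against total mass \<open>B\<close>; there the estimate is sharp.\<close>
  define s where "s = norm (\<integral>y. k y * f y \<partial>A) / B"
  define X where "X = (\<integral>\<^sup>+y. ennreal (norm (k y) * norm (f y) powr p) \<partial>A)"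
  have s: "0 < s" using False B by (simp add: s_def)
  have sB: "norm (\<integral>y. k y * f y \<partial>A) = s * B" using B by (simp add: s_def)
  \<comment> \<open>A non-integrable function has Bochner integral 0, so the nonzero case supplies
    integrability.\<close>
  have "integrable A (\<lambda>y. k y * f y)"
    using False not_integrable_integral_eq by blast
  then have "ennreal (s * B) \<le> (\<integral>\<^sup>+y. ennreal (norm (k y) * norm (f y)) \<partial>A)"
    unfolding sB[symmetric] using integral_norm_bound_ennreal by (fastforce simp: norm_mult)
  then have "ennreal (p * s powr (p - 1)) * ennreal (s * B) \<le>
      ennreal (p * s powr (p - 1)) * (\<integral>\<^sup>+y. ennreal (norm (k y) * norm (f y)) \<partial>A)"
    by (rule mult_left_mono) simp
  also have "\<dots> = (\<integral>\<^sup>+y. ennreal (norm (k y) * (p * s powr (p - 1) * norm (f y))) \<partial>A)"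
    using p by (subst nn_integral_cmult[symmetric]) (auto simp: ennreal_mult[symmetric] mult_ac)
  also have "\<dots> \<le> (\<integral>\<^sup>+y. ennreal (norm (k y) * norm (f y) powr p) + ennreal ((p - 1) * s powr p) * ennreal (norm (k y)) \<partial>A)"
  proof (rule nn_integral_mono)
    fix y
    have "norm (k y) * (p * s powr (p - 1) * norm (f y)) \<le> norm (k y) * (norm (f y) powr p + (p - 1) * s powr p)"
      using powr_above_tangent[OF p s, of "norm (f y)"] by (intro mult_left_mono) auto
    also have "\<dots> = norm (k y) * norm (f y) powr p + (p - 1) * s powr p * norm (k y)"
      by (simp add: algebra_simps)
    finally have "ennreal (norm (k y) * (p * s powr (p - 1) * norm (f y))) \<le> ennreal \<dots>"
      by (rule ennreal_leI)
    also have "\<dots> = ennreal (norm (k y) * norm (f y) powr p) + ennreal ((p - 1) * s powr p) * ennreal (norm (k y))"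
      unfolding ennreal_mult''[symmetric, OF norm_ge_zero] using p by (intro ennreal_plus) auto
    finally show "ennreal (norm (k y) * (p * s powr (p - 1) * norm (f y))) \<le>
       ennreal (norm (k y) * norm (f y) powr p) + ennreal ((p - 1) * s powr p) * ennreal (norm (k y))" .
  qed
  also have "\<dots> = X + ennreal ((p - 1) * s powr p) * (\<integral>\<^sup>+y. ennreal (norm (k y)) \<partial>A)"
    by (simp add: X_def nn_integral_add nn_integral_cmult)
  also have "\<dots> \<le> X + ennreal ((p - 1) * s powr p) * ennreal B"
    using B(2) by (intro add_left_mono mult_left_mono) auto
  finally have "ennreal (p * s powr (p - 1) * (s * B)) \<le> X + ennreal ((p - 1) * s powr p * B)"
    using p s B by (simp add: ennreal_mult)
  \<comment> \<open>By the choice of \<open>s\<close> the left side contains the same finite term as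
    the right side, which then cancels.\<close>
  also have "p * s powr (p - 1) * (s * B) = s powr p * B + (p - 1) * s powr p * B"
    using s by (simp add: powr_diff algebra_simps)
  finally have "ennreal (s powr p * B) + ennreal ((p - 1) * s powr p * B) \<le> X + ennreal ((p - 1) * s powr p * B)"
    using p s B by (simp add: ennreal_plus)
  then have "ennreal (s powr p * B) \<le> X"
    by (simp add: add.commute[of _ "ennreal ((p - 1) * s powr p * B)"] ennreal_add_left_cancel_le)
  then have "ennreal (B powr (p - 1)) * ennreal (s powr p * B) \<le> ennreal (B powr (p - 1)) * X"
    by (rule mult_left_mono) simp
  moreover have "B powr (p - 1) * (s powr p * B) = (s * B) powr p"
    using B s by (simp add: powr_diff powr_mult)
  ultimately show ?thesis
    using B s unfolding sB X_def[symmetric] by (simp add: ennreal_mult[symmetric])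
qed simp

text \<open>The rows contribute \<open>B powr (p - 1)\<close> through
  \<open>norm_integral_powr_le\<close>; exchanging the integrals lets the columns contribute the
  last factor \<open>B\<close>. Points \<open>x\<close> where the inner integral diverges have value
  0 and are covered by the same estimate.\<close>

lemma schur_test:
  fixes K :: "'a \<Rightarrow> 'a \<Rightarrow> complex"
  assumes "sigma_finite_measure A"
    and K [measurable]: "case_prod K \<in> borel_measurable (A \<Otimes>\<^sub>M A)"
    and p: "1 \<le> p" and f: "f \<in> Lp_space A p" and B: "0 < B"
    and row: "\<And>x. x \<in> space A \<Longrightarrow> (\<integral>\<^sup>+y. ennreal (norm (K x y)) \<partial>A) \<le> ennreal B"
    and col: "\<And>y. y \<in> space A \<Longrightarrow> (\<integral>\<^sup>+x. ennreal (norm (K x y)) \<partial>A) \<le> ennreal B"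
  shows "(\<lambda>x. \<integral>y. K x y * f y \<partial>A) \<in> Lp_space A p"
    and "(\<integral>x. norm (\<integral>y. K x y * f y \<partial>A) powr p \<partial>A) \<le> B powr p * (\<integral>x. norm (f x) powr p \<partial>A)"
proof -
  interpret sigma_finite_measure A by fact
  interpret pair_sigma_finite A A ..
  have f_meas [measurable]: "f \<in> borel_measurable A" and int: "integrable A (\<lambda>x. norm (f x) powr p)"
    using f by (auto simp: Lp_space_def)
  let ?T = "\<lambda>x. \<integral>y. K x y * f y \<partial>A"
  have "(\<integral>\<^sup>+x. ennreal (norm (?T x) powr p) \<partial>A) \<le>
      (\<integral>\<^sup>+x. ennreal (B powr (p - 1)) * (\<integral>\<^sup>+y. ennreal (norm (K x y) * norm (f y) powr p) \<partial>A) \<partial>A)"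
    by (intro nn_integral_mono norm_integral_powr_le p B row) measurable
  also have "\<dots> = ennreal (B powr (p - 1)) * (\<integral>\<^sup>+x. \<integral>\<^sup>+y. ennreal (norm (K x y) * norm (f y) powr p) \<partial>A \<partial>A)"
    by (rule nn_integral_cmult) measurable
  also have "(\<integral>\<^sup>+x. \<integral>\<^sup>+y. ennreal (norm (K x y) * norm (f y) powr p) \<partial>A \<partial>A) =
      (\<integral>\<^sup>+y. \<integral>\<^sup>+x. ennreal (norm (K x y) * norm (f y) powr p) \<partial>A \<partial>A)"
    by (rule Fubini'[symmetric]) measurable
  also have "\<dots> = (\<integral>\<^sup>+y. ennreal (norm (f y) powr p) * (\<integral>\<^sup>+x. ennreal (norm (K x y)) \<partial>A) \<partial>A)"
    by (intro nn_integral_cong, subst nn_integral_cmult[symmetric]) (auto simp: ennreal_mult mult.commute)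
  also have "\<dots> \<le> (\<integral>\<^sup>+y. ennreal (norm (f y) powr p) * ennreal B \<partial>A)"
    by (intro nn_integral_mono mult_left_mono col) auto
  also have "\<dots> = ennreal B * ennreal (\<integral>y. norm (f y) powr p \<partial>A)"
    using int by (subst nn_integral_multc) (auto simp: nn_integral_eq_integral mult.commute)
  finally have "(\<integral>\<^sup>+x. ennreal (norm (?T x) powr p) \<partial>A) \<le>
      ennreal (B powr (p - 1)) * (ennreal B * ennreal (\<integral>y. norm (f y) powr p \<partial>A))"
    by (simp add: mult_left_mono)
  also have "\<dots> = ennreal (B powr p * (\<integral>y. norm (f y) powr p \<partial>A))"
    using B by (simp add: ennreal_mult[symmetric] powr_diff)
  finally have le: "(\<integral>\<^sup>+x. ennreal (norm (?T x) powr p) \<partial>A) \<le> ennreal (B powr p * (\<integral>y. norm (f y) powr p \<partial>A))" .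
  have [measurable]: "?T \<in> borel_measurable A" by measurable
  have "integrable A (\<lambda>x. norm (?T x) powr p)"
    using le by (intro integrableI_nonneg) (auto intro: le_less_trans)
  then show "?T \<in> Lp_space A p" by (simp add: Lp_space_def)
  show "(\<integral>x. norm (?T x) powr p \<partial>A) \<le> B powr p * (\<integral>x. norm (f x) powr p \<partial>A)"
    by (rule integral_real_bounded[OF _ le]) simp
qed

lemma (in prob_space) Lp_space_integrable:
  assumes f: "f \<in> Lp_space M p" and p: "1 \<le> p"
  shows "integrable M f"
proof (rule Bochner_Integration.integrable_bound)
  show "integrable M (\<lambda>x. 1 + norm (f x) powr p)" using f by (auto simp: Lp_space_def)
  have "norm (f x) \<le> 1 + norm (f x) powr p" for x
  proof (cases "norm (f x) \<le> 1")
    case False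
    then have "norm (f x) powr 1 \<le> norm (f x) powr p" using p by (intro powr_mono) auto
    then show ?thesis by simp
  qed (simp add: add_increasing2)
  then show "AE x in M. norm (f x) \<le> norm (1 + norm (f x) powr p)" by (intro AE_I2) (simp add: add_nonneg_nonneg)
qed (use f in \<open>simp add: Lp_space_def\<close>)

section \<open>Uniform boundedness of the means on L^p\<close>

context vilenkin_group
begin

lemma noerlund_mean_eq_integral:
  assumes f: "integrable \<mu> f"
  shows "noerlund_mean m q n f x = (\<integral>y. noerlund_kern q n x y * f y \<partial>\<mu>)"
proof -
  have [simp]: "integrable \<mu> (\<lambda>y. f y * cnj (\<psi> i y))" for i
    using f by (rule Bochner_Integration.integrable_bound) (use f in \<open>auto simp: norm_mult\<close>)
  have *: "(\<integral>y. dirichlet k x y * f y \<partial>\<mu>) = partial_sum m k f x"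
      "integrable \<mu> (\<lambda>y. dirichlet k x y * f y)" for k
  proof -
    have "dirichlet k x y * f y = (\<Sum>i<k. \<psi> i x * (f y * cnj (\<psi> i y)))" for y
      by (simp add: dirichlet_def kern_def sum_distrib_left mult_ac)
    then show "(\<integral>y. dirichlet k x y * f y \<partial>\<mu>) = partial_sum m k f x" "integrable \<mu> (\<lambda>y. dirichlet k x y * f y)"
      by (simp_all add: partial_sum_def fourier_coeff_def mult.commute)
  qed
  have "(\<lambda>y. noerlund_kern q n x y * f y) =
     (\<lambda>y. of_real (1 / weight_sum q n) * (\<Sum>k=1..n. of_real (q (n - k)) * (dirichlet k x y * f y)))"
    by (simp add: noerlund_kern_def sum_distrib_right mult.assoc)
  then show ?thesis using * by (simp add: noerlund_mean_def)
qed

text \<open>Hermitian symmetry turns the row bound into the column bound of the Schur test.\<close>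

lemma noerlund_kern_sym: "noerlund_kern q n y x = cnj (noerlund_kern q n x y)"
  by (simp add: noerlund_kern_def dirichlet_def kern_def mult.commute)

lemma noerlund_kern_measurable: "case_prod (noerlund_kern q n) \<in> borel_measurable (\<mu> \<Otimes>\<^sub>M \<mu>)"
  unfolding noerlund_kern_def dirichlet_def kern_def by measurable

lemma integrable_noerlund_kern: "integrable \<mu> (\<lambda>y. noerlund_kern q n x y)"
  by (simp add: noerlund_kern_def)

lemma noerlund_mean_bounded:
  assumes bdd: "bdd_above (range m)" and q: "decseq q" "\<And>k. 0 \<le> q k" "0 < q 0"
    and Q: "(\<lambda>n. 1 / weight_sum q n) \<in> O(\<lambda>n. 1 / real n)" and p: "1 \<le> p"
  obtains C where "0 \<le> C" "eventually (\<lambda>n. \<forall>f \<in> Lp_space \<mu> p.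
    (\<integral>x. norm (noerlund_mean m q n f x) powr p \<partial>\<mu>) \<le> C * (\<integral>x. norm (f x) powr p \<partial>\<mu>)) sequentially"
proof -
  obtain d where d: "\<And>k. m k \<le> d" using bdd by (auto simp: bdd_above_def)
  define K where "K = real d + (real d)\<^sup>2 + (real d)^3"
  have "0 < d" using d[of 0] m_pos[of 0] by linarith
  then have K: "0 < K" by (simp add: K_def add_pos_pos)
  obtain c where c: "0 < c" and ev: "eventually (\<lambda>n. norm (1 / weight_sum q n) \<le> c * norm (1 / real n)) sequentially"
    using Q by (elim landau_o.bigE)
  \<comment> \<open>The factor \<open>n\<close> in the kernel bound cancels against
    \<open>1 / weight_sum q n \<le> c / n\<close>, leaving a constant independent of
    \<open>n\<close>.\<close>
  define B where "B = c * (2 * q 0 * K)"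
  have B: "0 < B" using c K q by (simp add: B_def)
  show ?thesis
  proof (rule that)
    show "0 \<le> B powr p" by simp
    show "eventually (\<lambda>n. \<forall>f \<in> Lp_space \<mu> p.
      (\<integral>x. norm (noerlund_mean m q n f x) powr p \<partial>\<mu>) \<le> B powr p * (\<integral>x. norm (f x) powr p \<partial>\<mu>)) sequentially"
      using ev eventually_gt_at_top[of 0]
    proof eventually_elim
      case (elim n)
      have row: "(\<integral>\<^sup>+y. ennreal (norm (noerlund_kern q n x y)) \<partial>\<mu>) \<le> ennreal B" if "x \<in> space \<mu>" for x
      proof -
        have "(\<integral>y. norm (noerlund_kern q n x y) \<partial>\<mu>) \<le> 1 / weight_sum q n * (2 * q 0 * (K * real n))"
          unfolding K_def by (rule integral_norm_noerlund_kern[OF that d q(1,2)])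
        also have "\<dots> \<le> (c * (1 / real n)) * (2 * q 0 * (K * real n))"
          using elim K q by (intro mult_right_mono) (auto simp: weight_sum_def sum_nonneg)
        also have "\<dots> = B" using elim by (simp add: B_def)
        finally show ?thesis
          by (subst nn_integral_eq_integral) (auto intro: integrable_noerlund_kern ennreal_leI)
      qed
      show ?case
      proof
        fix f assume f: "f \<in> Lp_space \<mu> p"
        have eq: "noerlund_mean m q n f = (\<lambda>x. \<integral>y. noerlund_kern q n x y * f y \<partial>\<mu>)"
          by (rule ext noerlund_mean_eq_integral Lp_space_integrable[OF f p])+
        show "(\<integral>x. norm (noerlund_mean m q n f x) powr p \<partial>\<mu>) \<le> B powr p * (\<integral>x. norm (f x) powr p \<partial>\<mu>)"
          unfolding eq
        proof (rule schur_test(2)[OF _ noerlund_kern_measurable p f B row])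
          show "(\<integral>\<^sup>+x. ennreal (norm (noerlund_kern q n x y)) \<partial>\<mu>) \<le> ennreal B" if "y \<in> space \<mu>" for y
            using row[OF that] by (simp add: noerlund_kern_sym[of q n _ y])
        qed unfold_locales
      qed
    qed
  qed
qed

end

section \<open>Vector space operations on L^p\<close>

lemma norm_add_powr_le:
  fixes a b :: complex
  assumes "0 \<le> p"
  shows "norm (a + b) powr p \<le> 2 powr p * (norm a powr p + norm b powr p)"
proof -
  have "norm (a + b) \<le> 2 * max (norm a) (norm b)"
    using norm_triangle_ineq[of a b] by linarith
  then have "norm (a + b) powr p \<le> (2 * max (norm a) (norm b)) powr p"
    using assms by (intro powr_mono2) auto
  also have "\<dots> = 2 powr p * max (norm a) (norm b) powr p"
    by (subst powr_mult) auto
  also have "\<dots> \<le> 2 powr p * (norm a powr p + norm b powr p)"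
    by (intro mult_left_mono) (auto simp: max_def)
  finally show ?thesis .
qed

lemma Lp_space_add:
  assumes f: "f \<in> Lp_space A p" and g: "g \<in> Lp_space A p" and p: "0 \<le> p"
  shows "(\<lambda>x. f x + g x) \<in> Lp_space A p"
    and "(\<integral>x. norm (f x + g x) powr p \<partial>A) \<le>
      2 powr p * ((\<integral>x. norm (f x) powr p \<partial>A) + (\<integral>x. norm (g x) powr p \<partial>A))"
proof -
  have [measurable]: "f \<in> borel_measurable A" "g \<in> borel_measurable A"
    and int: "integrable A (\<lambda>x. norm (f x) powr p)" "integrable A (\<lambda>x. norm (g x) powr p)"
    using f g by (auto simp: Lp_space_def)
  let ?h = "\<lambda>x. 2 powr p * (norm (f x) powr p + norm (g x) powr p)"
  have h: "integrable A ?h" using int by auto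
  have "integrable A (\<lambda>x. norm (f x + g x) powr p)"
    by (rule Bochner_Integration.integrable_bound[OF h])
      (auto intro!: AE_I2 order.trans[OF norm_add_powr_le[OF p]] simp del: norm_powr_real)
  then show "(\<lambda>x. f x + g x) \<in> Lp_space A p" by (simp add: Lp_space_def)
  have "(\<integral>x. norm (f x + g x) powr p \<partial>A) \<le> (\<integral>x. ?h x \<partial>A)"
    by (rule integral_mono') (use h norm_add_powr_le[OF p] in auto)
  also have "\<dots> = 2 powr p * ((\<integral>x. norm (f x) powr p \<partial>A) + (\<integral>x. norm (g x) powr p \<partial>A))"
    using int by simp
  finally show "(\<integral>x. norm (f x + g x) powr p \<partial>A) \<le>
      2 powr p * ((\<integral>x. norm (f x) powr p \<partial>A) + (\<integral>x. norm (g x) powr p \<partial>A))" .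
qed

lemma Lp_space_cmult:
  assumes f: "f \<in> Lp_space A p"
  shows "(\<lambda>x. c * f x) \<in> Lp_space A p"
proof -
  have [measurable]: "f \<in> borel_measurable A" and int: "integrable A (\<lambda>x. norm (f x) powr p)"
    using f by (auto simp: Lp_space_def)
  have "integrable A (\<lambda>x. norm c powr p * norm (f x) powr p)" using int by simp
  then show ?thesis by (simp add: Lp_space_def norm_mult powr_mult)
qed

lemma Lp_space_diff:
  assumes "f \<in> Lp_space A p" "g \<in> Lp_space A p" "0 \<le> p"
  shows "(\<lambda>x. f x - g x) \<in> Lp_space A p"
  using Lp_space_add(1)[OF assms(1) Lp_space_cmult[OF assms(2), of "-1"] assms(3)] by simp

lemma (in finite_measure) Lp_space_bounded:
  assumes "f \<in> borel_measurable M" "\<And>x. norm (f x) \<le> B" "0 \<le> p"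
  shows "f \<in> Lp_space M p"
proof -
  have "integrable M (\<lambda>x. norm (f x) powr p)"
    by (rule integrable_const_bound[where B = "B powr p"])
      (use assms in \<open>auto intro!: AE_I2 powr_mono2\<close>)
  then show ?thesis using assms by (simp add: Lp_space_def)
qed

section \<open>Linearity of the means, Vilenkin functions and cylinders\<close>

context vilenkin_group
begin

lemma noerlund_mean_add:
  assumes "integrable \<mu> f" "integrable \<mu> g"
  shows "noerlund_mean m q n (\<lambda>x. f x + g x) x = noerlund_mean m q n f x + noerlund_mean m q n g x"
proof -
  have int: "integrable \<mu> (\<lambda>y. h y * cnj (\<psi> i y))" if "integrable \<mu> h" for h i
    using that by (rule Bochner_Integration.integrable_bound) (use that in \<open>auto simp: norm_mult\<close>)
  have "fourier_coeff m (\<lambda>x. f x + g x) i = fourier_coeff m f i + fourier_coeff m g i" for i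
    unfolding fourier_coeff_def distrib_right using assms by (intro Bochner_Integration.integral_add int)
  then show ?thesis
    by (simp add: noerlund_mean_def partial_sum_def distrib_left distrib_right sum.distrib)
qed

lemma noerlund_mean_cmult:
  "noerlund_mean m q n (\<lambda>x. c * f x) x = c * noerlund_mean m q n f x"
proof -
  have "fourier_coeff m (\<lambda>x. c * f x) i = c * fourier_coeff m f i" for i
    by (simp add: fourier_coeff_def mult.assoc)
  then show ?thesis
    by (simp add: noerlund_mean_def partial_sum_def sum_distrib_left mult_ac)
qed

lemma partial_sum_vilenkin:
  "partial_sum m k (\<psi> i) x = (if i < k then \<psi> i x else 0)"
proof -
  have "fourier_coeff m (\<psi> i) j = (if i = j then 1 else 0)" for j
    unfolding fourier_coeff_def
    using gen_pow_gt[of m "max i j", OF m_ge_2] by (intro vilenkin_orthonormal) auto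
  then have "partial_sum m k (\<psi> i) x = (\<Sum>j<k. if j = i then \<psi> j x else 0)"
    unfolding partial_sum_def by (intro sum.cong) auto
  then show ?thesis by simp
qed

text \<open>Paley's formula, by which the indicator of a cylinder is a finite combination of
  Vilenkin functions. Each new coordinate multiplies by a geometric sum that tests agreement
  there.\<close>

lemma dirichlet_gen_pow:
  assumes "x \<in> space \<mu>" "y \<in> space \<mu>"
  shows "dirichlet (M N) x y = (if \<forall>k<N. x k = y k then of_nat (M N) else 0)"
proof (induction N)
  case 0
  then show ?case by (simp add: gen_pow_rec dirichlet_def kern_def vilenkin_0)
next
  case (Suc N)
  have "(\<Sum>b<m N. root N x y ^ b) = (if x N = y N then of_nat (m N) else 0)"
    unfolding root_def using assms by (intro sum_rademacher_pow) (auto simp: space_vilenkin_measure)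
  moreover have "(\<forall>k<Suc N. x k = y k) \<longleftrightarrow> (\<forall>k<N. x k = y k) \<and> x N = y N"
    by (auto simp: less_Suc_eq)
  ultimately show ?case
    unfolding dirichlet_gen_pow_Suc Suc by (auto simp: gen_pow_rec)
qed

definition cylinder :: "nat \<Rightarrow> (nat \<Rightarrow> nat) \<Rightarrow> (nat \<Rightarrow> nat) set" where
  "cylinder N z = {y \<in> space \<mu>. \<forall>k<N. y k = z k}"

lemma Int_stable_cylinder: "Int_stable {cylinder N z | N z. True}"
proof (rule Int_stableI)
  \<comment> \<open>The centre of a cylinder need not lie in the group: coordinate 0 of
    \<open>m\<close> is not below \<open>m 0\<close>. So the empty set is a cylinder, and as two
    cylinders are nested or disjoint, the family is closed under intersection.\<close>
  have empty: "{} = cylinder 1 m"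
    by (auto simp: cylinder_def space_vilenkin_measure dest!: spec[of _ 0])
  have *: "\<exists>K u. cylinder N z \<inter> cylinder N' z' = cylinder K u" if "N \<le> N'" for N N' z z'
  proof (cases "\<forall>k<N. z k = z' k")
    case True
    then have "cylinder N z \<inter> cylinder N' z' = cylinder N' z'"
      using that by (auto simp: cylinder_def)
    then show ?thesis by blast
  next
    case False
    then have "cylinder N z \<inter> cylinder N' z' = {}"
      using that by (auto simp: cylinder_def)
    then show ?thesis using empty by metis
  qed
  fix a b assume "a \<in> {cylinder N z | N z. True}" "b \<in> {cylinder N z | N z. True}"
  then obtain N z N' z' where "a = cylinder N z" "b = cylinder N' z'" by blast
  then show "a \<inter> b \<in> {cylinder N z | N z. True}"
    using *[of N N' z z'] *[of N' N z' z] by (cases "N \<le> N'") (auto simp: Int_commute)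
qed

lemma sets_vilenkin_measure: "sets \<mu> = sigma_sets (space \<mu>) {cylinder N z | N z. True}"
proof
  let ?S = "sigma_sets (space \<mu>) {cylinder N z | N z. True}"
  have sp: "(\<Pi>\<^sub>E i\<in>UNIV. space (uniform_count_measure {..<m i})) = space \<mu>"
    by (simp add: vilenkin_measure_def space_PiM)
  have "{f \<in> space \<mu>. f i \<in> A} \<in> ?S" for i A
  proof -
    \<comment> \<open>An event in coordinate \<open>i\<close> is the union of the cylinders over all
      admissible prefixes of length \<open>Suc i\<close>; there are finitely many because every
      factor is finite.\<close>
    let ?Z = "{z \<in> PiE {..<Suc i} (\<lambda>k. {..<m k}). z i \<in> A}"
    have "f \<in> \<Union>(cylinder (Suc i) ` ?Z)" if "f \<in> space \<mu>" "f i \<in> A" for f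
    proof
      show "f \<in> cylinder (Suc i) (restrict f {..<Suc i})" using that by (simp add: cylinder_def)
    qed (use that in \<open>auto simp: space_vilenkin_measure\<close>)
    then have "{f \<in> space \<mu>. f i \<in> A} = \<Union>(cylinder (Suc i) ` ?Z)"
      by (auto simp: cylinder_def)
    also have "\<dots> \<in> ?S"
    proof (rule sigma_sets_UNION)
      have "finite ?Z" by (intro finite_subset[OF _ finite_PiE[of "{..<Suc i}" "\<lambda>k. {..<m k}"]]) auto
      then show "countable (cylinder (Suc i) ` ?Z)" by (intro countable_finite finite_imageI)
    qed auto
    finally show ?thesis .
  qed
  moreover have "sets \<mu> = sigma_sets (space \<mu>)
      {{f \<in> space \<mu>. f i \<in> A} | i A. i \<in> UNIV \<and> A \<in> sets (uniform_count_measure {..<m i})}"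
    unfolding sp[symmetric] unfolding vilenkin_measure_def by (rule sets_PiM_single)
  ultimately show "sets \<mu> \<subseteq> ?S"
    by (auto intro!: sigma_sets_mono simp del: sigma_sets_le_sets_iff)
next
  show "sigma_sets (space \<mu>) {cylinder N z | N z. True} \<subseteq> sets \<mu>"
  proof (rule sets.sigma_sets_subset)
    have [measurable]: "(\<lambda>y. y k) \<in> measurable \<mu> (count_space UNIV)" for k
      by (rule measurable_compose[OF component_measurable])
        (simp add: measurable_def space_uniform_count_measure sets_uniform_count_measure)
    have "cylinder N z \<in> sets \<mu>" for N z
      unfolding cylinder_def by measurable
    then show "{cylinder N z | N z. True} \<subseteq> sets \<mu>" by auto
  qed
qed

end

section \<open>The closed subspace on which the means converge\<close>

locale noerlund = vilenkin_group +
  fixes q :: "nat \<Rightarrow> real" and p :: real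
  assumes m_bounded: "bdd_above (range m)" and p_ge_1: "1 \<le> p"
    and q_noninc: "decseq q" and q_nonneg: "\<And>k. 0 \<le> q k" and q0_pos: "0 < q 0"
    and Q_bound: "(\<lambda>n. 1 / weight_sum q n) \<in> O(\<lambda>n. 1 / real n)"
begin

abbreviation "noerl \<equiv> noerlund_mean m q"

definition dist_pow :: "((nat \<Rightarrow> nat) \<Rightarrow> complex) \<Rightarrow> ((nat \<Rightarrow> nat) \<Rightarrow> complex) \<Rightarrow> real" where
  "dist_pow f g = (\<integral>x. norm (f x - g x) powr p \<partial>\<mu>)"

definition approximable :: "((nat \<Rightarrow> nat) \<Rightarrow> complex) \<Rightarrow> bool" where
  "approximable f \<longleftrightarrow> f \<in> Lp_space \<mu> p \<and> (\<lambda>n. dist_pow (noerl n f) f) \<longlonglongrightarrow> 0"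

lemma p_nonneg: "0 \<le> p" using p_ge_1 by simp

lemma dist_pow_nonneg: "0 \<le> dist_pow f g"
  by (simp add: dist_pow_def)

lemma approximable_add:
  assumes f: "approximable f" and g: "approximable g"
  shows "approximable (\<lambda>x. f x + g x)"
proof -
  have fg: "f \<in> Lp_space \<mu> p" "g \<in> Lp_space \<mu> p"
    using f g by (auto simp: approximable_def)
  have le: "dist_pow (noerl n (\<lambda>x. f x + g x)) (\<lambda>x. f x + g x) \<le>
      2 powr p * (dist_pow (noerl n f) f + dist_pow (noerl n g) g)" for n
  proof -
    have "noerl n (\<lambda>x. f x + g x) x - (f x + g x) = (noerl n f x - f x) + (noerl n g x - g x)" for x
      using fg[THEN Lp_space_integrable[OF _ p_ge_1]] by (simp add: noerlund_mean_add)
    then show ?thesis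
      unfolding dist_pow_def
      by (simp only: Lp_space_add(2) noerlund_error_in_Lp m_ge_2 p_ge_1 fg p_nonneg)
  qed
  have "(\<lambda>n. 2 powr p * (dist_pow (noerl n f) f + dist_pow (noerl n g) g)) \<longlonglongrightarrow> 2 powr p * (0 + 0)"
    using f g by (intro tendsto_intros) (simp_all add: approximable_def)
  then have lim: "(\<lambda>n. 2 powr p * (dist_pow (noerl n f) f + dist_pow (noerl n g) g)) \<longlonglongrightarrow> 0"
    by simp
  have "(\<lambda>n. dist_pow (noerl n (\<lambda>x. f x + g x)) (\<lambda>x. f x + g x)) \<longlonglongrightarrow> 0"
    by (rule tendsto_sandwich[OF _ _ tendsto_const lim]) (simp_all add: dist_pow_nonneg le)
  then show ?thesis
    using Lp_space_add(1)[OF fg p_nonneg] by (simp add: approximable_def)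
qed

lemma approximable_cmult:
  assumes f: "approximable f"
  shows "approximable (\<lambda>x. c * f x)"
proof -
  have "dist_pow (noerl n (\<lambda>x. c * f x)) (\<lambda>x. c * f x) = norm c powr p * dist_pow (noerl n f) f" for n
    by (simp add: dist_pow_def noerlund_mean_cmult right_diff_distrib[symmetric] norm_mult powr_mult)
  moreover have "(\<lambda>n. norm c powr p * dist_pow (noerl n f) f) \<longlonglongrightarrow> norm c powr p * 0"
    using f by (intro tendsto_intros) (simp_all add: approximable_def)
  ultimately show ?thesis using f Lp_space_cmult[of f \<mu> p c] by (simp add: approximable_def)
qed

lemma approximable_zero: "approximable (\<lambda>_. 0)"
  by (simp add: approximable_def dist_pow_def noerlund_mean_def partial_sum_def fourier_coeff_def Lp_space_def)

lemma approximable_sum: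
  "finite I \<Longrightarrow> (\<And>i. i \<in> I \<Longrightarrow> approximable (f i)) \<Longrightarrow> approximable (\<lambda>x. \<Sum>i\<in>I. f i x)"
  by (induction I rule: finite_induct) (simp_all add: approximable_zero approximable_add)

lemma weight_sum_pos: "0 < n \<Longrightarrow> 0 < weight_sum q n"
  unfolding weight_sum_def using q_nonneg q0_pos by (intro sum_pos2[of _ 0]) simp_all

lemma inverse_weight_sum_tendsto: "(\<lambda>n. 1 / weight_sum q n) \<longlonglongrightarrow> 0"
proof -
  have "(\<lambda>n. 1 / real n) \<in> o(\<lambda>_. 1)"
    using lim_1_over_n by (intro smalloI_tendsto) simp_all
  from smalloD_tendsto[OF landau_o.big_small_trans[OF Q_bound this]] show ?thesis
    by simp
qed

text \<open>For \<open>k > i\<close> the partial sum \<open>S_k\<close> reproduces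
  \<open>\<psi> i\<close>, and otherwise it vanishes. So the error consists of at most
  \<open>i\<close> missing terms, each weighted by at most \<open>q 0\<close>, and dies with the
  reciprocal of \<open>weight_sum q n\<close>, uniformly in \<open>x\<close>.\<close>

lemma approximable_vilenkin: "approximable (\<psi> i)"
proof -
  have bound: "norm (noerl n (\<psi> i) x - \<psi> i x) \<le> real i * q 0 * (1 / weight_sum q n)" if n: "0 < n" for n x
  proof -
    define W where "W = weight_sum q n"
    \<comment> \<open>Reversing the order of summation shows that the weights in the mean add up to
      the normalizing factor, so the mean minus \<open>\<psi> i\<close> retains only the missing
      terms.\<close>
    have W: "W = (\<Sum>k=1..n. q (n - k))" 
      unfolding W_def weight_sum_def
      by (rule sum.reindex_bij_witness[of _ "\<lambda>k. n - k" "\<lambda>k. n - k"]) auto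
    have W0: "0 < W" unfolding W_def by (rule weight_sum_pos[OF n])
    have "noerl n (\<psi> i) x - \<psi> i x = of_real (1 / W) * ((\<Sum>k=1..n. of_real (q (n - k)) * (if i < k then \<psi> i x else 0)) - of_real W * \<psi> i x)"
      using W0 by (simp add: noerlund_mean_def partial_sum_vilenkin W_def right_diff_distrib)
    also have "(\<Sum>k=1..n. of_real (q (n - k)) * (if i < k then \<psi> i x else 0)) - of_real W * \<psi> i x =
        - (\<Sum>k=1..n. of_real (q (n - k)) * (if i < k then 0 else \<psi> i x))"
      unfolding W of_real_sum sum_distrib_right sum_subtractf[symmetric] sum_negf[symmetric]
      by (intro sum.cong) auto
    finally have "norm (noerl n (\<psi> i) x - \<psi> i x) =
        1 / W * norm (\<Sum>k=1..n. of_real (q (n - k)) * (if i < k then 0 else \<psi> i x))"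
      using W0 by (simp add: norm_mult norm_divide)
    also have "\<dots> \<le> 1 / W * (\<Sum>k=1..n. if k \<in> {1..i} then q 0 else 0)"
    proof (intro mult_left_mono sum_norm_le)
      fix k assume "k \<in> {1..n}"
      moreover have "q (n - k) \<le> q 0" using q_noninc by (simp add: decseqD)
      ultimately show "norm (of_real (q (n - k)) * (if i < k then 0 else \<psi> i x)) \<le> (if k \<in> {1..i} then q 0 else 0)"
        using q_nonneg[of "n - k"] by (simp add: norm_mult)
    qed (use W0 in simp)
    also have "(\<Sum>k=1..n. if k \<in> {1..i} then q 0 else 0) = (\<Sum>k\<in>{1..n} \<inter> {1..i}. q 0)"
      by (rule sum.inter_restrict[symmetric]) simp
    also have "\<dots> \<le> real i * q 0"
      using q_nonneg[of 0] card_mono[of "{1..i}" "{1..n} \<inter> {1..i}"] by (auto intro!: mult_right_mono)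
    finally show ?thesis using W0 by (simp add: W_def mult.commute divide_right_mono)
  qed
  have le: "dist_pow (noerl n (\<psi> i)) (\<psi> i) \<le> (real i * q 0 * (1 / weight_sum q n)) powr p" if "0 < n" for n
  proof -
    have "dist_pow (noerl n (\<psi> i)) (\<psi> i) \<le> (\<integral>x. (real i * q 0 * (1 / weight_sum q n)) powr p \<partial>\<mu>)"
      unfolding dist_pow_def by (intro integral_mono' powr_mono2 p_nonneg bound[OF that]) simp_all
    then show ?thesis by (simp add: prob_space)
  qed
  have "(\<lambda>n. real i * q 0 * (1 / weight_sum q n)) \<longlonglongrightarrow> real i * q 0 * 0"
    by (intro tendsto_intros inverse_weight_sum_tendsto)
  then have lim: "(\<lambda>n. (real i * q 0 * (1 / weight_sum q n)) powr p) \<longlonglongrightarrow> 0"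
    using p_ge_1 q_nonneg
    by (intro tendsto_zero_powrI[OF _ tendsto_const] always_eventually) (auto simp: weight_sum_def sum_nonneg)
  have "(\<lambda>n. dist_pow (noerl n (\<psi> i)) (\<psi> i)) \<longlonglongrightarrow> 0"
    by (rule tendsto_sandwich[OF _ eventually_mono[OF eventually_gt_at_top[of 0] le] tendsto_const lim])
      (simp add: dist_pow_nonneg)
  moreover have "\<psi> i \<in> Lp_space \<mu> p"
    using p_nonneg by (intro Lp_space_bounded[of _ 1]) auto
  ultimately show ?thesis by (simp add: approximable_def)
qed

text \<open>The decomposition is t_n f - f = t_n(f - g) + (t_n g - g) + (g - f). The first part is
  controlled by the bound \<open>C\<close>, which is uniform in \<open>n\<close>, so
  \<open>g = g i\<close> can be fixed before \<open>n\<close> grows. The quasi-triangle inequality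
  is applied twice, which produces the factor \<open>c * C + c * c\<close>.\<close>

lemma approximable_limit:
  assumes f: "f \<in> Lp_space \<mu> p" and g: "\<And>i. approximable (g i)"
    and lim: "(\<lambda>i. dist_pow f (g i)) \<longlonglongrightarrow> 0"
  shows "approximable f"
proof -
  obtain C where C: "0 \<le> C" and ev: "eventually (\<lambda>n. \<forall>f \<in> Lp_space \<mu> p.
    (\<integral>x. norm (noerl n f x) powr p \<partial>\<mu>) \<le> C * (\<integral>x. norm (f x) powr p \<partial>\<mu>)) sequentially"
    using noerlund_mean_bounded[OF m_bounded q_noninc q_nonneg q0_pos Q_bound p_ge_1] .
  define c where "c = (2::real) powr p"
  have "(\<lambda>n. dist_pow (noerl n f) f) \<longlonglongrightarrow> 0"
  proof (rule order_tendstoI)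
    fix e :: real assume "0 < e"
    have "(\<lambda>i. (c * C + c * c) * dist_pow f (g i)) \<longlonglongrightarrow> (c * C + c * c) * 0"
      by (intro tendsto_intros lim)
    then have "eventually (\<lambda>i. (c * C + c * c) * dist_pow f (g i) < e / 2) sequentially"
      by (rule order_tendstoD(2)) (use \<open>0 < e\<close> in simp)
    then obtain i where i: "(c * C + c * c) * dist_pow f (g i) < e / 2"
      using eventually_happens'[OF sequentially_bot] by blast
    have gi: "g i \<in> Lp_space \<mu> p" using g[of i] by (simp add: approximable_def)
    have h: "(\<lambda>x. f x - g i x) \<in> Lp_space \<mu> p" "(\<lambda>x. g i x - f x) \<in> Lp_space \<mu> p"
      by (rule Lp_space_diff[OF f gi p_nonneg], rule Lp_space_diff[OF gi f p_nonneg])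
    have "(\<lambda>n. c * c * dist_pow (noerl n (g i)) (g i)) \<longlonglongrightarrow> c * c * 0"
      using g[of i] unfolding approximable_def by (intro tendsto_intros) auto
    then have "eventually (\<lambda>n. c * c * dist_pow (noerl n (g i)) (g i) < e / 2) sequentially"
      by (rule order_tendstoD(2)) (use \<open>0 < e\<close> in simp)
    then show "eventually (\<lambda>n. dist_pow (noerl n f) f < e) sequentially"
      using ev
    proof eventually_elim
      case (elim n)
      define u v w where "u = (\<lambda>x. noerl n (\<lambda>x. f x - g i x) x)" and "v = (\<lambda>x. noerl n (g i) x - g i x)"
        and "w = (\<lambda>x. g i x - f x)"
      \<comment> \<open>Membership is known for the error of a mean; adding the function back gives
        it for the mean \<open>u\<close> itself.\<close>
      have "(\<lambda>x. (u x - (f x - g i x)) + (f x - g i x)) \<in> Lp_space \<mu> p"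
        unfolding u_def
        by (rule Lp_space_add(1)[OF noerlund_error_in_Lp[OF m_ge_2 p_ge_1 h(1)] h(1) p_nonneg])
      then have u: "u \<in> Lp_space \<mu> p" by simp
      have v: "v \<in> Lp_space \<mu> p"
        unfolding v_def by (rule noerlund_error_in_Lp[OF m_ge_2 p_ge_1 gi])
      have w: "w \<in> Lp_space \<mu> p" using h by (simp add: w_def)
      have "noerl n f x - f x = u x + (v x + w x)" for x
        using noerlund_mean_add[OF Lp_space_integrable[OF h(1) p_ge_1] Lp_space_integrable[OF gi p_ge_1], of q n x]
        by (simp add: u_def v_def w_def)
      then have "dist_pow (noerl n f) f = (\<integral>x. norm (u x + (v x + w x)) powr p \<partial>\<mu>)"
        by (simp add: dist_pow_def)
      also have "\<dots> \<le> c * ((\<integral>x. norm (u x) powr p \<partial>\<mu>) + (\<integral>x. norm (v x + w x) powr p \<partial>\<mu>))"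
        unfolding c_def by (intro Lp_space_add u v w p_nonneg)
      also have "\<dots> \<le> c * (C * dist_pow f (g i) + c * (dist_pow (noerl n (g i)) (g i) + dist_pow f (g i)))"
      proof (intro mult_left_mono add_mono)
        show "(\<integral>x. norm (u x) powr p \<partial>\<mu>) \<le> C * dist_pow f (g i)"
          using elim h(1) by (simp add: u_def dist_pow_def)
        show "(\<integral>x. norm (v x + w x) powr p \<partial>\<mu>) \<le> c * (dist_pow (noerl n (g i)) (g i) + dist_pow f (g i))"
          using Lp_space_add(2)[OF v w p_nonneg]
          by (simp add: c_def v_def w_def dist_pow_def norm_minus_commute)
      qed (simp add: c_def)
      also have "\<dots> = (c * C + c * c) * dist_pow f (g i) + c * c * dist_pow (noerl n (g i)) (g i)"
        by (simp add: algebra_simps)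
      also have "\<dots> < e" using i elim by linarith
      finally show ?case .
    qed
  next
    fix a :: real assume "a < 0"
    then show "eventually (\<lambda>n. a < dist_pow (noerl n f) f) sequentially"
      by (intro always_eventually allI less_le_trans[OF _ dist_pow_nonneg])
  qed
  with f show ?thesis by (simp add: approximable_def)
qed

text \<open>A constant sequence at distance 0 is an instance of closedness.\<close>

lemma approximable_cong:
  assumes f: "approximable f" and eq: "\<And>x. x \<in> space \<mu> \<Longrightarrow> f x = g x"
  shows "approximable g"
proof (rule approximable_limit)
  have "(\<integral>x. norm (g x - f x) powr p \<partial>\<mu>) = (\<integral>x. 0 \<partial>\<mu>)"
    by (intro Bochner_Integration.integral_cong) (auto simp: eq)
  then show "(\<lambda>i::nat. dist_pow g f) \<longlonglongrightarrow> 0" by (simp add: dist_pow_def)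
  have "g \<in> borel_measurable \<mu> \<longleftrightarrow> f \<in> borel_measurable \<mu>"
    by (intro measurable_cong) (simp add: eq)
  moreover have "integrable \<mu> (\<lambda>x. norm (g x) powr p) \<longleftrightarrow> integrable \<mu> (\<lambda>x. norm (f x) powr p)"
    by (intro Bochner_Integration.integrable_cong) (simp_all add: eq)
  ultimately show "g \<in> Lp_space \<mu> p" using f by (simp add: approximable_def Lp_space_def)
qed (rule f)

section \<open>From cylinders to all of L^p\<close>

text \<open>The factor 2 is the one that comes with pointwise approximation by simple functions. It
  passes to the limit \<open>f\<close>, so \<open>f - g i\<close> is dominated by 4 times
  \<open>h\<close>, and dominated convergence applies to the p-th powers.\<close>

lemma approximable_dominated:
  assumes f: "f \<in> borel_measurable \<mu>" and g: "\<And>i. approximable (g i)"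
    and lim: "\<And>x. x \<in> space \<mu> \<Longrightarrow> (\<lambda>i. g i x) \<longlonglongrightarrow> f x"
    and h: "h \<in> Lp_space \<mu> p" and bd: "\<And>i x. x \<in> space \<mu> \<Longrightarrow> norm (g i x) \<le> 2 * norm (h x)"
  shows "approximable f"
proof -
  have [measurable]: "f \<in> borel_measurable \<mu>" "g i \<in> borel_measurable \<mu>" "h \<in> borel_measurable \<mu>" for i
    using f g h by (auto simp: approximable_def Lp_space_def)
  have int: "integrable \<mu> (\<lambda>x. norm (h x) powr p)" using h by (simp add: Lp_space_def)
  have fh: "norm (f x) \<le> 2 * norm (h x)" if "x \<in> space \<mu>" for x
    by (rule tendsto_upperbound[OF tendsto_norm[OF lim[OF that]]]) (auto intro: always_eventually bd that)
  then have fh4: "norm (f x) \<le> 4 * norm (h x)" if "x \<in> space \<mu>" for x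
    using that norm_ge_zero[of "h x"] by (smt (verit))
  have le: "z powr p \<le> 4 powr p * norm (h x) powr p" if "0 \<le> z" "z \<le> 4 * norm (h x)" for z x
    using powr_mono2[OF p_nonneg that] by (simp add: powr_mult)
  show ?thesis
  proof (rule approximable_limit[OF _ g])
    have "integrable \<mu> (\<lambda>x. norm (f x) powr p)"
      by (rule Bochner_Integration.integrable_bound[where f = "\<lambda>x. 4 powr p * norm (h x) powr p"])
        (use int fh4 in \<open>auto intro!: AE_I2 le\<close>)
    then show "f \<in> Lp_space \<mu> p" by (simp add: Lp_space_def)
    have "(\<lambda>i. dist_pow f (g i)) \<longlonglongrightarrow> (\<integral>x. 0 \<partial>\<mu>)"
      unfolding dist_pow_def
    proof (rule integral_dominated_convergence[where w = "\<lambda>x. 4 powr p * norm (h x) powr p"])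
      show "AE x in \<mu>. (\<lambda>i. norm (f x - g i x) powr p) \<longlonglongrightarrow> 0"
      proof (rule AE_I2)
        fix x assume "x \<in> space \<mu>"
        then have "(\<lambda>i. norm (f x - g i x)) \<longlonglongrightarrow> norm (f x - f x)"
          by (intro tendsto_intros lim)
        then show "(\<lambda>i. norm (f x - g i x) powr p) \<longlonglongrightarrow> 0"
          using p_ge_1 by (intro tendsto_zero_powrI[OF _ tendsto_const]) auto
      qed
      show "AE x in \<mu>. norm (norm (f x - g i x) powr p) \<le> 4 powr p * norm (h x) powr p" for i
      proof (rule AE_I2)
        fix x assume x: "x \<in> space \<mu>"
        have "norm (f x - g i x) \<le> 4 * norm (h x)"
          using norm_triangle_ineq4[of "f x" "g i x"] fh[OF x] bd[OF x, of i] by linarith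
        then show "norm (norm (f x - g i x) powr p) \<le> 4 powr p * norm (h x) powr p"
          by (simp add: le)
      qed
    qed (use int in auto)
    then show "(\<lambda>i. dist_pow f (g i)) \<longlonglongrightarrow> 0" by simp
  qed
qed

text \<open>Paley's formula requires points of the group, so an element \<open>x\<close> of the
  cylinder takes the place of the centre \<open>z\<close>; the empty cylinder is treated
  apart.\<close>

lemma approximable_cylinder: "approximable (indicator (cylinder N z))"
proof (cases "cylinder N z = {}")
  case True
  then show ?thesis using approximable_zero by (simp add: indicator_def[abs_def])
next
  case False
  then obtain x where x: "x \<in> cylinder N z" by blast
  have [simp]: "M N \<noteq> 0" by (simp add: gen_pow_def)
  have "approximable (\<lambda>y. 1 / of_nat (M N) * (\<Sum>i<M N. cnj (\<psi> i x) * \<psi> i y))"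
    by (intro approximable_cmult approximable_sum approximable_vilenkin) simp
  then show ?thesis
  proof (rule approximable_cong)
    fix y assume y: "y \<in> space \<mu>"
    have "(\<Sum>i<M N. cnj (\<psi> i x) * \<psi> i y) = dirichlet (M N) y x"
      by (simp add: dirichlet_def kern_def mult.commute)
    then show "1 / of_nat (M N) * (\<Sum>i<M N. cnj (\<psi> i x) * \<psi> i y) = indicator (cylinder N z) y"
      using x y by (auto simp: dirichlet_gen_pow cylinder_def indicator_def)
  qed
qed

lemma approximable_indicator:
  assumes "A \<in> sets \<mu>"
  shows "approximable (indicator A)"
proof -
  have A: "A \<in> sigma_sets (space \<mu>) {cylinder N z | N z. True}"
    using assms by (simp only: sets_vilenkin_measure)
  have "{cylinder N z | N z. True} \<subseteq> Pow (space \<mu>)" by (auto simp: cylinder_def)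
  from Int_stable_cylinder this A have "A \<in> sets \<mu> \<and> approximable (indicator A)"
  proof (induction rule: sigma_sets_induct_disjoint)
    case (basic A)
    then show ?case using approximable_cylinder sets_vilenkin_measure by auto
  next
    case empty
    then show ?case using approximable_zero by (simp add: indicator_def[abs_def])
  next
    case (compl A)
    \<comment> \<open>The constant 1 is \<open>\<psi> 0\<close>, so complements stay in the space by
      linearity.\<close>
    have "approximable (\<lambda>x. \<psi> 0 x + (- 1) * indicator A x)"
      using compl by (intro approximable_add approximable_cmult approximable_vilenkin) auto
    then have "approximable (indicator (space \<mu> - A))"
      by (rule approximable_cong) (auto simp: vilenkin_0 indicator_def)
    then show ?case using compl by auto
  next
    case (union A)
    have A: "A i \<in> sets \<mu>" "approximable (indicator (A i))" for i
      using union(3)[of i] by blast+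
    have UN: "(\<Union>i. A i) \<in> sets \<mu>" using A(1) by (intro sets.countable_UN) blast
    have approx: "approximable (indicator (\<Union>i<n. A i))" for n
    proof (rule approximable_cong)
      show "approximable (\<lambda>x. \<Sum>i<n. indicator (A i) x)"
        by (rule approximable_sum[OF finite_lessThan A(2)])
      have "disjoint_family_on A {..<n}"
        using subset_UNIV union(1) by (rule disjoint_family_on_mono)
      then show "(\<Sum>i<n. indicator (A i) x) = (indicator (\<Union>i<n. A i) x :: complex)" for x
        by (rule indicator_UN_disjoint[OF finite_lessThan, symmetric])
    qed
    \<comment> \<open>By disjointness the finite unions are finite sums of indicators; they converge
      pointwise to the full union and are dominated by the constant 1.\<close>
    have "approximable (indicator (\<Union>i. A i))"
    proof (rule approximable_dominated[OF _ approx LIMSEQ_indicator_UN])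
      show "indicator (\<Union>i. A i) \<in> borel_measurable \<mu>" using UN by simp
      show "(\<lambda>_. 1) \<in> Lp_space \<mu> p" using p_nonneg by (intro Lp_space_bounded[of _ 1]) auto
      show "norm (indicator (\<Union>i<n. A i) x :: complex) \<le> 2 * norm (1 :: complex)" for n x
        by (simp add: indicator_def)
    qed
    with UN show ?case by blast
  qed
  then show ?thesis by simp
qed

lemma approximable_simple:
  assumes s: "simple_function \<mu> s"
  shows "approximable s"
proof -
  have "approximable (\<lambda>x. \<Sum>y\<in>s ` space \<mu>. y * indicator (s -` {y} \<inter> space \<mu>) x)"
    using s by (intro approximable_sum approximable_cmult approximable_indicator)
      (auto simp: simple_function_def)
  then show ?thesis
  proof (rule approximable_cong)
    fix x assume x: "x \<in> space \<mu>"
    have "(\<Sum>y\<in>s ` space \<mu>. y * indicator (s -` {y} \<inter> space \<mu>) x) = (\<Sum>y\<in>s ` space \<mu>. if y = s x then y else 0)"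
      using x by (intro sum.cong) (auto simp: indicator_def)
    then show "(\<Sum>y\<in>s ` space \<mu>. y * indicator (s -` {y} \<inter> space \<mu>) x) = s x"
      using x s by (simp add: simple_function_def)
  qed
qed

lemma approximable_Lp:
  assumes f: "f \<in> Lp_space \<mu> p"
  shows "approximable f"
proof -
  have fm: "f \<in> borel_measurable \<mu>" using f by (simp add: Lp_space_def)
  from borel_measurable_implies_sequence_metric[OF this, of 0] obtain s where
    "\<And>i. simple_function \<mu> (s i)" "\<And>x. x \<in> space \<mu> \<Longrightarrow> (\<lambda>i. s i x) \<longlonglongrightarrow> f x"
    "\<And>i x. x \<in> space \<mu> \<Longrightarrow> norm (s i x) \<le> 2 * norm (f x)"
    by simp metis
  then show ?thesis by (intro approximable_dominated[OF fm _ _ f] approximable_simple)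
qed

end

theorem theorem2p4p2:
  fixes m :: "nat \<Rightarrow> nat" and q :: "nat \<Rightarrow> real" and p :: real
    and f :: "(nat \<Rightarrow> nat) \<Rightarrow> complex"
  assumes m_ge_2: "\<And>k. 2 \<le> m k"
    and m_bounded: "bdd_above (range m)"
    and p_ge_1: "1 \<le> p"
    and f_in_Lp: "f \<in> Lp_space (vilenkin_measure m) p"
    and q_noninc: "decseq q"
    and q_nonneg: "\<And>k. 0 \<le> q k"
    and q0_pos: "0 < q 0"
    and Q_bound: "(\<lambda>n. 1 / weight_sum q n) \<in> O(\<lambda>n. 1 / real n)"
  shows "(\<lambda>n. Lp_norm (vilenkin_measure m) p (\<lambda>x. noerlund_mean m q n f x - f x)) \<longlonglongrightarrow> 0"
proof -
  interpret noerlund m q p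
    by unfold_locales (fact assms)+
  have "(\<lambda>n. dist_pow (noerlund_mean m q n f) f) \<longlonglongrightarrow> 0"
    using approximable_Lp[OF f_in_Lp] by (simp add: approximable_def)
  then have "(\<lambda>n. dist_pow (noerlund_mean m q n f) f powr (1 / p)) \<longlonglongrightarrow> 0"
    using p_ge_1 by (intro tendsto_zero_powrI[OF _ tendsto_const]) (auto simp: dist_pow_nonneg)
  then show ?thesis by (simp add: Lp_norm_def dist_pow_def)
qed

end
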